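(* Let $G$ be a non-discrete LCA group with dual $\Gamma$, $V$ an open neighbourhood of $0\in\Gamma$ with compact closure $\bar V$, and let $(\mathcal S,\|\cdot\|_{\mathcal S})$ be a Segal algebra in $(\mathcal A(\Gamma),\|\cdot\|^{\bar V})$. Then (i) $\mathbb M(\mathcal S)\supseteq C^{\bar V}_{BSE}(\Gamma)$; (ii) if $\mathcal S$ is isometrically translation invariant, then $\mathbb M(\mathcal S)=C^{\bar V}_{BSE}(\Gamma)$.
   Context: $G$ non-discrete LCA with dual $\Gamma$, $(x,\gamma)=\gamma(x)$. For $E\subseteq\Gamma$, $\mathrm{span}(E)$ is the span of the characters in $E$ as functions on $G$, each $p=\sum\hat p(\gamma)\gamma$ uniquely, $\|p\|_\infty=\sup_G|p|$. For $\phi\in C_b(\Gamma)$: $\|\phi\|^{\bar V,\gamma}=\sup\{|\sum_{\gamma'\in\bar V+\gamma}\hat p(\gamma')\phi(\gamma')|:p\in\mathrm{span}(\bar V+\gamma),\|p\|_\infty\le1\}$, $\|\phi\|^{\bar V}=\sup_\gamma\|\phi\|^{\bar V,\gamma}$, $C^{\bar V}_{BSE}(\Gamma)=\{\phi\in C_b(\Gamma):\|\phi\|^{\bar V}<\infty\}$. With $\mathcal K(\Gamma)$ the compact subsets of $\Gamma$ with dense nonempty interior directed by inclusion, $\mathcal A(\Gamma)=\{\psi\in C^{\bar V}_{BSE}(\Gamma):\lim_{\Omega\in\mathcal K(\Gamma)}\sup_{\gamma\notin\Omega}\|\psi\|^{\bar V,\gamma}=0\}$, a commutative Banach function algebra under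 pointwise operations and $\|\cdot\|^{\bar V}$. A Segal algebra in $\mathcal A(\Gamma)$ is a dense ideal $\mathcal S$ that is a Banach space under a norm $\|\cdot\|_{\mathcal S}\ge\|\cdot\|^{\bar V}$, with $\|\phi\psi\|_{\mathcal S}\le\|\phi\|_{\mathcal S}\|\psi\|^{\bar V}$ ($\phi\in\mathcal S,\psi\in\mathcal A(\Gamma)$), and having approximate units (for each $\phi\in\mathcal S$, $\varepsilon>0$ some $u\in\mathcal S$ has $\|\phi-u\phi\|_{\mathcal S}<\varepsilon$). It is isometrically translation invariant if $\psi\in\mathcal S$ implies $\psi(\cdot-\gamma)\in\mathcal S$ with the same norm for every $\gamma\in\Gamma$. $\mathbb M(\mathcal S)=\{\phi\in C_b(\Gamma):\phi\psi\in\mathcal S\ \forall\psi\in\mathcal S\}$ (the multiplier algebra, identified with functions on $\Gamma$), with operator norm $\|\phi\|_{\mathbb M(\mathcal S)}$. *)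

theory Defs
  imports "HOL-Analysis.Analysis"
begin

definition is_character :: "('g::topological_ab_group_add \<Rightarrow> complex) \<Rightarrow> bool" where
  "is_character ch \<longleftrightarrow> continuous_on UNIV ch \<and> (\<forall>x. norm (ch x) = 1)
     \<and> (\<forall>x y. ch (x + y) = ch x * ch y)"

text \<open>The type 'a (group Gamma) together with the pairing (x,gamma) is the dual group of
  the LCA group 'g: gamma maps bijectively onto the continuous characters, addition in Gamma
  is pointwise multiplication of characters, and the topology of Gamma is the compact-open
  topology (topology of uniform convergence on compacta).\<close>
definition is_dual_pairing ::
  "('g::{topological_ab_group_add,t2_space} \<Rightarrow> 'a::{topological_ab_group_add} \<Rightarrow> complex) \<Rightarrow> bool" where
  "is_dual_pairing pair \<longleftrightarrow>
     locally_compact_space (euclidean :: 'g topology)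
   \<and> (\<forall>\<gamma>. is_character (\<lambda>x. pair x \<gamma>))
   \<and> inj (\<lambda>\<gamma> x. pair x \<gamma>)
   \<and> (\<forall>ch. is_character ch \<longrightarrow> (\<exists>\<gamma>. ch = (\<lambda>x. pair x \<gamma>)))
   \<and> (\<forall>x \<gamma> \<delta>. pair x (\<gamma> + \<delta>) = pair x \<gamma> * pair x \<delta>)
   \<and> (\<forall>U::'a set. open U \<longleftrightarrow>
        generate_topology_on
          {{\<gamma>. \<forall>x\<in>K. pair x \<gamma> \<in> W} | K W. compact K \<and> open W} U)"

text \<open>Local BSE-type norm: the sup over trigonometric polynomials p with frequencies in the
  translate Vb + gamma (given by finite frequency set F and coefficients c) with sup-norm at
  most 1 on G.\<close>
definition bse_loc ::
  "('g \<Rightarrow> 'a::ab_group_add \<Rightarrow> complex) \<Rightarrow> 'a set \<Rightarrow> ('a \<Rightarrow> complex) \<Rightarrow> 'a \<Rightarrow> ereal" where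
  "bse_loc pair Vb \<phi> \<gamma> =
     (SUP Fc \<in> {(F, c). finite F \<and> F \<subseteq> (\<lambda>v. v + \<gamma>) ` Vb
                 \<and> (\<forall>x. norm (\<Sum>\<gamma>'\<in>F. c \<gamma>' * pair x \<gamma>') \<le> 1)}.
        ereal (norm (\<Sum>\<gamma>'\<in>fst Fc. snd Fc \<gamma>' * \<phi> \<gamma>')))"

definition bse_norm ::
  "('g \<Rightarrow> 'a::ab_group_add \<Rightarrow> complex) \<Rightarrow> 'a set \<Rightarrow> ('a \<Rightarrow> complex) \<Rightarrow> ereal" where
  "bse_norm pair Vb \<phi> = (SUP \<gamma>. bse_loc pair Vb \<phi> \<gamma>)"

definition Cb :: "('a::topological_space \<Rightarrow> complex) set" where
  "Cb = {\<phi>. continuous_on UNIV \<phi> \<and> bounded (range \<phi>)}"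

definition C_BSE ::
  "('g \<Rightarrow> 'a::{ab_group_add,topological_space} \<Rightarrow> complex) \<Rightarrow> 'a set \<Rightarrow> ('a \<Rightarrow> complex) set" where
  "C_BSE pair Vb = {\<phi> \<in> Cb. bse_norm pair Vb \<phi> < \<infinity>}"

definition KGamma :: "('a::topological_space) set set" where
  "KGamma = {\<Omega>. compact \<Omega> \<and> interior \<Omega> \<noteq> {} \<and> \<Omega> \<subseteq> closure (interior \<Omega>)}"

definition A_alg ::
  "('g \<Rightarrow> 'a::{ab_group_add,topological_space} \<Rightarrow> complex) \<Rightarrow> 'a set \<Rightarrow> ('a \<Rightarrow> complex) set" where
  "A_alg pair Vb = {\<psi> \<in> C_BSE pair Vb.
      \<forall>\<epsilon>>0. \<exists>\<Omega>0\<in>KGamma. \<forall>\<Omega>\<in>KGamma. \<Omega>0 \<subseteq> \<Omega> \<longrightarrow>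
         (SUP \<gamma>\<in>-\<Omega>. bse_loc pair Vb \<psi> \<gamma>) \<le> ereal \<epsilon>}"

definition segal_algebra ::
  "('g \<Rightarrow> 'a::{ab_group_add,topological_space} \<Rightarrow> complex) \<Rightarrow> 'a set \<Rightarrow>
   ('a \<Rightarrow> complex) set \<Rightarrow> (('a \<Rightarrow> complex) \<Rightarrow> real) \<Rightarrow> bool" where
  "segal_algebra pair Vb S nS \<longleftrightarrow>
     S \<subseteq> A_alg pair Vb
   \<comment> \<open>linear subspace\<close>
   \<and> (\<lambda>t. 0) \<in> S \<and> (\<forall>\<phi>\<in>S. \<forall>\<psi>\<in>S. (\<lambda>t. \<phi> t + \<psi> t) \<in> S) \<and> (\<forall>a::complex. \<forall>\<phi>\<in>S. (\<lambda>t. a * \<phi> t) \<in> S)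
   \<comment> \<open>ideal in A(Gamma)\<close>
   \<and> (\<forall>\<phi>\<in>S. \<forall>\<psi>\<in>A_alg pair Vb. (\<lambda>t. \<phi> t * \<psi> t) \<in> S)
   \<comment> \<open>dense in A(Gamma) for bse_norm\<close>
   \<and> (\<forall>\<psi>\<in>A_alg pair Vb. \<forall>\<epsilon>>0. \<exists>\<phi>\<in>S. bse_norm pair Vb (\<lambda>t. \<psi> t - \<phi> t) < ereal \<epsilon>)
   \<comment> \<open>nS is a norm on S\<close>
   \<and> (\<forall>\<phi>\<in>S. nS \<phi> \<ge> 0 \<and> (nS \<phi> = 0 \<longleftrightarrow> \<phi> = (\<lambda>t. 0)))
   \<and> (\<forall>\<phi>\<in>S. \<forall>\<psi>\<in>S. nS (\<lambda>t. \<phi> t + \<psi> t) \<le> nS \<phi> + nS \<psi>)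
   \<and> (\<forall>a::complex. \<forall>\<phi>\<in>S. nS (\<lambda>t. a * \<phi> t) = norm a * nS \<phi>)
   \<comment> \<open>completeness (Banach space)\<close>
   \<and> (\<forall>f::nat \<Rightarrow> ('a \<Rightarrow> complex). (\<forall>n. f n \<in> S) \<longrightarrow>
        (\<forall>\<epsilon>>0. \<exists>N. \<forall>m\<ge>N. \<forall>n\<ge>N. nS (\<lambda>t. f m t - f n t) < \<epsilon>) \<longrightarrow>
        (\<exists>\<phi>\<in>S. (\<lambda>n. nS (\<lambda>t. f n t - \<phi> t)) \<longlonglongrightarrow> 0))
   \<comment> \<open>norm domination and module inequality\<close>
   \<and> (\<forall>\<phi>\<in>S. bse_norm pair Vb \<phi> \<le> ereal (nS \<phi>))
   \<and> (\<forall>\<phi>\<in>S. \<forall>\<psi>\<in>A_alg pair Vb. ereal (nS (\<lambda>t. \<phi> t * \<psi> t)) \<le> ereal (nS \<phi>) * bse_norm pair Vb \<psi>)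
   \<comment> \<open>approximate units\<close>
   \<and> (\<forall>\<phi>\<in>S. \<forall>\<epsilon>>0. \<exists>u\<in>S. nS (\<lambda>t. \<phi> t - u t * \<phi> t) < \<epsilon>)"

definition isometrically_translation_invariant ::
  "('a::ab_group_add \<Rightarrow> complex) set \<Rightarrow> (('a \<Rightarrow> complex) \<Rightarrow> real) \<Rightarrow> bool" where
  "isometrically_translation_invariant S nS \<longleftrightarrow>
     (\<forall>\<psi>\<in>S. \<forall>\<gamma>. (\<lambda>t. \<psi> (t - \<gamma>)) \<in> S \<and> nS (\<lambda>t. \<psi> (t - \<gamma>)) = nS \<psi>)"

definition multipliers :: "('a::topological_space \<Rightarrow> complex) set \<Rightarrow> ('a \<Rightarrow> complex) set" where
  "multipliers S = {\<phi> \<in> Cb. \<forall>\<psi>\<in>S. (\<lambda>t. \<phi> t * \<psi> t) \<in> S}"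

end

theory Submission
  imports Defs
begin

text \<open>For (i), one approximates \<open>\<psi> \<in> S\<close> by \<open>e * \<psi>\<close> with \<open>e\<close> running through a norm-bounded family of
  compactly supported functions; then \<open>\<phi> * e\<close> lies in the algebra, with bounds independent of \<open>e\<close>.
  For (ii), compactly supported functions of the algebra lie in \<open>S\<close>, so that translates of one
  plateau function bound the local norms of a multiplier (gliding hump). The plateau functions need
  neither Haar measure nor Fourier inversion: the local norm only sees the compact set \<open>closure V + \<gamma>\<close>,
  on which a finite product of functions of \<open>Re (pair x \<gamma>)\<close> is a bump of finite norm.\<close>

section \<open>Functions with bounded pairings against trigonometric polynomials\<close>

text \<open>Continuity alone gives no control of these norms, so each cut-off must come from a
  closed calculus of bounded functions. It can rest on \<open>\<bar>Re (pair x t) - c\<bar>\<close>: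
  on the circle \<open>\<bar>cos \<theta> - c\<bar>\<close> has an absolutely convergent Fourier
  series, and each \<open>pair (n * x)\<close> has norm at most 1. Here a square-root iteration
  stands in for the series; linear combinations of such functions are ramps that are exactly 0 and
  exactly 1 on open sets. Two needs shape the rest. The approximate units of \<open>S\<close> carry
  neither a common bound nor compact support, so they are traded for plateau functions whose bound
  must not depend on the plateau. This is possible because the norm is a supremum over translates:
  boundedly overlapping pieces do not accumulate. In \<open>nS\<close> they may accumulate, so the
  humps in (ii) need summable weights, which the growth of the local norms has to beat.\<close>

definition bse_bound ::
  "('g \<Rightarrow> 'a \<Rightarrow> complex) \<Rightarrow> 'a set \<Rightarrow> ('a \<Rightarrow> complex) \<Rightarrow> real \<Rightarrow> bool" where
  "bse_bound pair T \<phi> B \<longleftrightarrow>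
     (\<forall>F c. finite F \<longrightarrow> F \<subseteq> T \<longrightarrow> (\<forall>x. norm (\<Sum>\<gamma>\<in>F. c \<gamma> * pair x \<gamma>) \<le> 1) \<longrightarrow>
        norm (\<Sum>\<gamma>\<in>F. c \<gamma> * \<phi> \<gamma>) \<le> B)"

text \<open>Real bounds replace suprema in \<open>ereal\<close> from here on. The frequency set in
  \<open>bse_bound\<close> is arbitrary, so that an estimate on \<open>UNIV\<close> can be
  restricted to any translate.\<close>

lemma bse_loc_le_iff:
  "bse_loc pair Vb \<phi> \<gamma> \<le> ereal B \<longleftrightarrow> bse_bound pair ((\<lambda>v. v + \<gamma>) ` Vb) \<phi> B"
  unfolding bse_loc_def bse_bound_def by (auto simp: SUP_le_iff)

lemma bse_norm_le_iff:
  "bse_norm pair Vb \<phi> \<le> ereal B \<longleftrightarrow> (\<forall>\<gamma>. bse_bound pair ((\<lambda>v. v + \<gamma>) ` Vb) \<phi> B)"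
  unfolding bse_norm_def by (auto simp: SUP_le_iff bse_loc_le_iff)

lemma bse_norm_finite_iff:
  "bse_norm pair Vb \<phi> < \<infinity> \<longleftrightarrow> (\<exists>B. \<forall>\<gamma>. bse_bound pair ((\<lambda>v. v + \<gamma>) ` Vb) \<phi> B)"
proof -
  have "bse_norm pair Vb \<phi> < \<infinity> \<longleftrightarrow> (\<exists>B. bse_norm pair Vb \<phi> \<le> ereal B)"
    by (cases "bse_norm pair Vb \<phi>") auto
  then show ?thesis by (simp add: bse_norm_le_iff)
qed

lemma bse_bound_nonneg: "bse_bound pair T \<phi> B \<Longrightarrow> 0 \<le> B"
  unfolding bse_bound_def by (drule spec[of _ "{}"]) auto

lemma bse_bound_mono:
  assumes "bse_bound pair T \<phi> B" "T' \<subseteq> T" "B \<le> B'"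
  shows "bse_bound pair T' \<phi> B'"
  unfolding bse_bound_def
proof (intro allI impI)
  fix F c assume "finite F" "F \<subseteq> T'" "\<forall>x. norm (\<Sum>\<gamma>\<in>F. c \<gamma> * pair x \<gamma>) \<le> 1"
  then have "norm (\<Sum>\<gamma>\<in>F. c \<gamma> * \<phi> \<gamma>) \<le> B"
    using assms(1)[unfolded bse_bound_def, rule_format, of F c] assms(2) by blast
  then show "norm (\<Sum>\<gamma>\<in>F. c \<gamma> * \<phi> \<gamma>) \<le> B'" using assms(3) by linarith
qed

lemma bse_bound_cong:
  assumes "\<And>t. t \<in> T \<Longrightarrow> \<phi> t = \<psi> t"
  shows "bse_bound pair T \<phi> B \<longleftrightarrow> bse_bound pair T \<psi> B"
proof -
  have "(\<Sum>\<gamma>\<in>F. c \<gamma> * \<phi> \<gamma>) = (\<Sum>\<gamma>\<in>F. c \<gamma> * \<psi> \<gamma>)" if "F \<subseteq> T" for F c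
    using that assms by (intro sum.cong) auto
  then show ?thesis unfolding bse_bound_def by simp
qed

lemma bse_bound_zero: "0 \<le> B \<Longrightarrow> bse_bound pair T (\<lambda>t. 0) B"
  by (simp add: bse_bound_def)

lemma bse_bound_scaled:
  assumes \<phi>: "bse_bound pair T \<phi> B" and F: "finite F" "F \<subseteq> T"
    and p: "\<And>x. norm (\<Sum>\<gamma>\<in>F. c \<gamma> * pair x \<gamma>) \<le> M"
  shows "norm (\<Sum>\<gamma>\<in>F. c \<gamma> * \<phi> \<gamma>) \<le> M * B"
proof -
  have *: "r * norm (\<Sum>\<gamma>\<in>F. c \<gamma> * \<phi> \<gamma>) \<le> B" if r: "r \<ge> 0" "r * M \<le> 1" for r :: real
  proof -
    have scale: "(\<Sum>\<gamma>\<in>F. of_real r * c \<gamma> * f \<gamma>) = of_real r * (\<Sum>\<gamma>\<in>F. c \<gamma> * f \<gamma>)"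
      for f :: "_ \<Rightarrow> complex"
      by (simp add: sum_distrib_left mult.assoc)
    have "norm (\<Sum>\<gamma>\<in>F. of_real r * c \<gamma> * pair x \<gamma>) \<le> 1" for x
      using mult_left_mono[OF p[of x] r(1)] r by (simp add: scale norm_mult)
    then have "norm (\<Sum>\<gamma>\<in>F. (of_real r * c \<gamma>) * \<phi> \<gamma>) \<le> B"
      using \<phi>[unfolded bse_bound_def, rule_format, of F "\<lambda>\<gamma>. of_real r * c \<gamma>"] F by simp
    then show ?thesis using r by (simp add: scale norm_mult)
  qed
  have "0 \<le> M" using norm_ge_zero p[of undefined] by (rule order_trans)
  show ?thesis
  proof (cases "M = 0")
    case False
    then show ?thesis using *[of "1 / M"] \<open>0 \<le> M\<close> by (simp add: field_simps)
  next
    case True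
    show ?thesis
    proof (rule ccontr)
      assume "\<not> ?thesis"
      then have pos: "norm (\<Sum>\<gamma>\<in>F. c \<gamma> * \<phi> \<gamma>) > 0" using True by simp
      \<comment> \<open>For \<open>M = 0\<close> every multiple of the polynomial is admissible.
        This factor \<open>r\<close> would turn a nonzero pairing into the value
        \<open>B + 1\<close>.\<close>
      show False
        using *[of "(B + 1) / norm (\<Sum>\<gamma>\<in>F. c \<gamma> * \<phi> \<gamma>)"] pos True bse_bound_nonneg[OF \<phi>] by simp
    qed
  qed
qed

lemma bse_bound_add:
  assumes "bse_bound pair T \<phi> A" "bse_bound pair T \<psi> B"
  shows "bse_bound pair T (\<lambda>t. \<phi> t + \<psi> t) (A + B)"
  unfolding bse_bound_def
proof (intro allI impI)
  fix F c assume "finite F" "F \<subseteq> T" "\<forall>x. norm (\<Sum>\<gamma>\<in>F. c \<gamma> * pair x \<gamma>) \<le> 1"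
  then have "norm (\<Sum>\<gamma>\<in>F. c \<gamma> * \<phi> \<gamma>) \<le> A" "norm (\<Sum>\<gamma>\<in>F. c \<gamma> * \<psi> \<gamma>) \<le> B"
    using assms[unfolded bse_bound_def, rule_format, of F c] by blast+
  then show "norm (\<Sum>\<gamma>\<in>F. c \<gamma> * (\<phi> \<gamma> + \<psi> \<gamma>)) \<le> A + B"
    unfolding distrib_left sum.distrib by (rule norm_triangle_mono)
qed

lemma bse_bound_cmult:
  assumes "bse_bound pair T \<phi> B"
  shows "bse_bound pair T (\<lambda>t. a * \<phi> t) (norm a * B)"
  unfolding bse_bound_def
proof (intro allI impI)
  fix F c assume "finite F" "F \<subseteq> T" "\<forall>x. norm (\<Sum>\<gamma>\<in>F. c \<gamma> * pair x \<gamma>) \<le> 1"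
  then have "norm (\<Sum>\<gamma>\<in>F. c \<gamma> * \<phi> \<gamma>) \<le> B"
    using assms[unfolded bse_bound_def, rule_format, of F c] by simp
  moreover have "(\<Sum>\<gamma>\<in>F. c \<gamma> * (a * \<phi> \<gamma>)) = a * (\<Sum>\<gamma>\<in>F. c \<gamma> * \<phi> \<gamma>)"
    by (simp add: sum_distrib_left mult.left_commute)
  ultimately show "norm (\<Sum>\<gamma>\<in>F. c \<gamma> * (a * \<phi> \<gamma>)) \<le> norm a * B"
    by (simp add: norm_mult mult_left_mono)
qed

lemma bse_bound_diff:
  assumes "bse_bound pair T \<phi> A" "bse_bound pair T \<psi> B"
  shows "bse_bound pair T (\<lambda>t. \<phi> t - \<psi> t) (A + B)"
  using bse_bound_add[OF assms(1) bse_bound_cmult[OF assms(2), of "-1"]] by simp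

text \<open>Each test polynomial involves finitely many frequencies, so pointwise convergence
  suffices.\<close>

lemma bse_bound_lim:
  assumes "\<And>n::nat. bse_bound pair T (f n) B" "\<And>t. t \<in> T \<Longrightarrow> (\<lambda>n. f n t) \<longlonglongrightarrow> \<phi> t"
  shows "bse_bound pair T \<phi> B"
  unfolding bse_bound_def
proof (intro allI impI)
  fix F c assume F: "finite F" "F \<subseteq> T" "\<forall>x. norm (\<Sum>\<gamma>\<in>F. c \<gamma> * pair x \<gamma>) \<le> 1"
  have "(\<lambda>n. norm (\<Sum>\<gamma>\<in>F. c \<gamma> * f n \<gamma>)) \<longlonglongrightarrow> norm (\<Sum>\<gamma>\<in>F. c \<gamma> * \<phi> \<gamma>)"
    using F assms(2) by (intro tendsto_intros) auto
  moreover have "norm (\<Sum>\<gamma>\<in>F. c \<gamma> * f n \<gamma>) \<le> B" for n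
    using assms(1)[unfolded bse_bound_def, rule_format, of F c] F by simp
  ultimately show "norm (\<Sum>\<gamma>\<in>F. c \<gamma> * \<phi> \<gamma>) \<le> B"
    by (intro LIMSEQ_le_const2) auto
qed

section \<open>Real preliminaries: an iteration for the square root, and ramps\<close>

lemma sqrt_iteration_tendsto:
  fixes y :: "nat \<Rightarrow> real"
  assumes w: "0 \<le> w" "w \<le> 1" and y0: "y 0 = 0" and ySuc: "\<And>n. y (Suc n) = (w + (y n)\<^sup>2) / 2"
  shows "y \<longlonglongrightarrow> 1 - sqrt (1 - w)"
proof -
  \<comment> \<open>The smaller root of \<open>w + u\<^sup>2 = 2 * u\<close>. The iterates increase
    from 0 and stay below it, and the only fixed point that is at most \<open>L\<close> is
    \<open>L\<close>.\<close>
  define L where "L = 1 - sqrt (1 - w)"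
  have "w + L\<^sup>2 = 2 * L" using w by (simp add: L_def power2_eq_square algebra_simps)
  then have L: "0 \<le> L" "L \<le> 1" "(w + L\<^sup>2) / 2 = L"
    using w by (auto simp: L_def)
  have bd: "0 \<le> y n \<and> y n \<le> L" for n
  proof (induction n)
    case (Suc n)
    then have "(y n)\<^sup>2 \<le> L\<^sup>2" by (intro power_mono) auto
    then show ?case using w L by (simp add: ySuc)
  qed (use y0 L in auto)
  have "y n \<le> y (Suc n)" for n
  proof (induction n)
    case (Suc n)
    then have "(y n)\<^sup>2 \<le> (y (Suc n))\<^sup>2" using bd by (intro power_mono) auto
    then show ?case by (simp add: ySuc[of n] ySuc[of "Suc n"])
  qed (use y0 bd in auto)
  then have "incseq y" by (rule incseq_SucI)
  then obtain l where l: "y \<longlonglongrightarrow> l" "\<And>n. y n \<le> l"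
    using incseq_convergent[of y L] bd by blast
  have "(\<lambda>n. y (Suc n)) \<longlonglongrightarrow> (w + l\<^sup>2) / 2"
    unfolding ySuc by (intro tendsto_intros l) simp
  then have "l = (w + l\<^sup>2) / 2" using l(1) LIMSEQ_Suc LIMSEQ_unique by blast
  then have "(1 - l)\<^sup>2 = (1 - L)\<^sup>2" using L(3) by (simp add: power2_eq_square algebra_simps)
  moreover have "l \<le> L" using l(1) bd by (intro LIMSEQ_le_const2) auto
  ultimately have "1 - l = 1 - L" using L(2) by (intro power2_eq_imp_eq[of "1 - l" "1 - L"]) auto
  then have "l = L" by simp
  then show ?thesis using l by (simp add: L_def)
qed

text \<open>For \<open>c < d\<close> this is the ramp that is 0 up to \<open>c\<close>, 1 from
  \<open>d\<close> on and linear between. Absolute values are used because those are what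
  \<open>bse_bound_abs_Re_pair\<close> estimates.\<close>

definition trapezoid :: "real \<Rightarrow> real \<Rightarrow> real \<Rightarrow> real" where
  "trapezoid c d u = 1 / (2 * (d - c)) * (\<bar>u - c\<bar> - \<bar>u - d\<bar> + (d - c))"

lemma trapezoid_lower: "c < d \<Longrightarrow> u \<le> c \<Longrightarrow> trapezoid c d u = 0"
  by (simp add: trapezoid_def)

lemma trapezoid_upper: "c < d \<Longrightarrow> d \<le> u \<Longrightarrow> trapezoid c d u = 1"
  by (simp add: trapezoid_def field_simps)

section \<open>Separated subsets of compact sets\<close>

lemma compact_plus:
  fixes A B :: "'a::topological_ab_group_add set"
  assumes "compact A" "compact B"
  shows "compact {a + b |a b. a \<in> A \<and> b \<in> B}"
proof -
  have "continuous_on (A \<times> B) (\<lambda>z. fst z + snd z)"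
    by (intro continuous_intros)
  then have "compact ((\<lambda>z. fst z + snd z) ` (A \<times> B))"
    using assms by (intro compact_continuous_image compact_Times)
  moreover have "(\<lambda>z. fst z + snd z) ` (A \<times> B) = {a + b |a b. a \<in> A \<and> b \<in> B}" by force
  ultimately show ?thesis by simp
qed

lemma compact_minus:
  fixes A B :: "'a::topological_ab_group_add set"
  assumes "compact A" "compact B"
  shows "compact {a - b |a b. a \<in> A \<and> b \<in> B}"
proof -
  have "compact (uminus ` B)"
    by (intro compact_continuous_image continuous_intros assms)
  from compact_plus[OF assms(1) this] show ?thesis
    by (rule back_subst[of compact]) force
qed

lemma compact_translation_group:
  fixes A :: "'a::topological_ab_group_add set"
  shows "compact A \<Longrightarrow> compact ((\<lambda>v. v + \<gamma>) ` A)"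
  by (intro compact_continuous_image continuous_intros)

lemma open_translation_group:
  fixes A :: "'a::topological_ab_group_add set"
  assumes "open A"
  shows "open ((\<lambda>v. v + \<gamma>) ` A)"
proof -
  have "open ((\<lambda>t. t - \<gamma>) -` A)"
    by (intro open_vimage assms continuous_intros)
  moreover have "(\<lambda>t. t - \<gamma>) -` A = (\<lambda>v. v + \<gamma>) ` A" by force
  ultimately show ?thesis by simp
qed

text \<open>For a compact set \<open>M\<close>, the size of a \<open>W\<close>-separated subset of a translate of \<open>M\<close> is
  bounded by the number of translates of \<open>U\<close> needed to cover \<open>M\<close>, where \<open>U - U \<subseteq> W\<close>.\<close>

lemma separated_card_bound:
  fixes M W :: "'a::topological_ab_group_add set"
  assumes "compact M" "open W" "0 \<in> W"
  shows "\<exists>N. \<forall>\<gamma> J. J \<subseteq> (\<lambda>v. v + \<gamma>) ` M \<longrightarrow> pairwise (\<lambda>a b. a - b \<notin> W) J \<longrightarrow>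
    finite J \<and> card J \<le> N"
proof -
  define P where "P = (\<lambda>z::'a \<times> 'a. fst z - snd z) -` W"
  have P: "open P" "(0,0) \<in> P" "\<And>a b. (a, b) \<in> P \<Longrightarrow> a - b \<in> W"
    unfolding P_def using assms by (auto intro!: open_vimage continuous_intros)
  obtain A B where AB: "open A" "open B" "0 \<in> A" "0 \<in> B" "A \<times> B \<subseteq> P"
    using P(1,2) by (auto elim: open_prod_elim)
  define U where "U = A \<inter> B"
  have U: "open U" "0 \<in> U" "\<And>a b. a \<in> U \<Longrightarrow> b \<in> U \<Longrightarrow> a - b \<in> W"
    using AB P(3) unfolding U_def by auto
  have "M \<subseteq> (\<Union>m\<in>M. (\<lambda>v. v + m) ` U)" using U(2) by force
  then obtain D where D: "finite D" "M \<subseteq> (\<Union>m\<in>D. (\<lambda>v. v + m) ` U)"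
    using compactE_image[OF assms(1), of M "\<lambda>m. (\<lambda>v. v + m) ` U"] open_translation_group[OF U(1)]
    by metis
  have "finite J \<and> card J \<le> card D"
    if J: "J \<subseteq> (\<lambda>v. v + \<gamma>) ` M" and sep: "pairwise (\<lambda>a b. a - b \<notin> W) J" for \<gamma> J
  proof -
    have "\<exists>m. m \<in> D \<and> j - \<gamma> - m \<in> U" if j: "j \<in> J" for j
    proof -
      have "j - \<gamma> \<in> M" using j J by auto
      then obtain m u where "m \<in> D" "u \<in> U" "j - \<gamma> = u + m" using D(2) by blast
      then show ?thesis by (intro exI[of _ m]) simp
    qed
    then obtain f where f: "\<And>j. j \<in> J \<Longrightarrow> f j \<in> D \<and> j - \<gamma> - f j \<in> U" by metis
    have "inj_on f J"
    proof (rule inj_onI, rule ccontr)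
      fix a b assume ab: "a \<in> J" "b \<in> J" "f a = f b" "a \<noteq> b"
      have "(a - \<gamma> - f a) - (b - \<gamma> - f b) \<in> W" using U(3) f ab by blast
      then show False using pairwiseD[OF sep ab(1,2,4)] ab(3) by simp
    qed
    then show ?thesis
      using f D(1) by (meson card_inj_on_le image_subset_iff inj_on_finite)
  qed
  then show ?thesis by blast
qed

text \<open>A separated subset of \<open>K\<close> of largest size exists by
  \<open>separated_card_bound\<close>; a point it failed to cover could be added to it. Symmetry of
  \<open>W\<close> handles both orders of a pair.\<close>

lemma separated_cover:
  fixes K W :: "'a::topological_ab_group_add set"
  assumes "compact K" "open W" "0 \<in> W" "\<And>w. w \<in> W \<Longrightarrow> - w \<in> W"
  shows "\<exists>J. finite J \<and> pairwise (\<lambda>a b. a - b \<notin> W) J \<and> (\<forall>k\<in>K. \<exists>j\<in>J. k - j \<in> W)"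
proof -
  define sep where "sep J \<longleftrightarrow> J \<subseteq> K \<and> pairwise (\<lambda>a b. a - b \<notin> W) J" for J
  obtain N where N: "\<And>\<gamma> J. J \<subseteq> (\<lambda>v. v + \<gamma>) ` K \<Longrightarrow> pairwise (\<lambda>a b. a - b \<notin> W) J \<Longrightarrow>
      finite J \<and> card J \<le> N"
    using separated_card_bound[OF assms(1-3)] by blast
  have bd: "finite J \<and> card J \<le> N" if "sep J" for J
    using N[of J 0] that unfolding sep_def by simp
  have "sep {}" by (simp add: sep_def)
  moreover have "\<forall>J. sep J \<longrightarrow> card J < Suc N" using bd by (simp add: less_Suc_eq_le)
  ultimately have "\<exists>J. sep J \<and> (\<forall>J'. sep J' \<longrightarrow> card J' \<le> card J)"
    by (rule ex_has_greatest_nat)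
  then obtain J where J: "sep J" "\<And>J'. sep J' \<Longrightarrow> card J' \<le> card J" by blast
  have "\<exists>j\<in>J. k - j \<in> W" if k: "k \<in> K" for k
  proof (rule ccontr)
    assume *: "\<not> ?thesis"
    then have "k \<notin> J" using assms(3) by (metis diff_self)
    have "j - k \<notin> W" if "j \<in> J" for j using assms(4)[of "j - k"] * that by auto
    then have "sep (insert k J)" using * J(1) k unfolding sep_def pairwise_insert by blast
    then show False using J(2)[of "insert k J"] bd[OF J(1)] \<open>k \<notin> J\<close> by simp
  qed
  then show ?thesis using J(1) bd unfolding sep_def by blast
qed

section \<open>Bump and plateau functions\<close>

locale pairing =
  fixes pair :: "'g::ab_group_add \<Rightarrow> 'a::topological_ab_group_add \<Rightarrow> complex"
  assumes norm_pair [simp]: "norm (pair x \<gamma>) = 1"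
    and pair_add_left: "pair (x + y) \<gamma> = pair x \<gamma> * pair y \<gamma>"
    and pair_add_right: "pair x (\<gamma> + \<delta>) = pair x \<gamma> * pair x \<delta>"
    and continuous_pair: "continuous_on UNIV (pair x)"
    and pair_separates: "\<gamma> \<noteq> 0 \<Longrightarrow> \<exists>x. pair x \<gamma> \<noteq> 1"
begin

section \<open>Products and translates of functions with bounded pairings\<close>

lemma pair_nonzero [simp]: "pair x \<gamma> \<noteq> 0"
  using norm_pair[of x \<gamma>] by (metis norm_zero zero_neq_one)

lemma pair_zero_left [simp]: "pair 0 \<gamma> = 1"
  using pair_add_left[of 0 0 \<gamma>] by simp

lemma pair_zero_right [simp]: "pair x 0 = 1"
  using pair_add_right[of x 0 0] by simp

lemma pair_minus_left: "pair (- x) \<gamma> = cnj (pair x \<gamma>)"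
proof -
  have "pair x \<gamma> * pair (- x) \<gamma> = 1" using pair_add_left[of x "- x" \<gamma>] by simp
  moreover have "pair x \<gamma> * cnj (pair x \<gamma>) = 1" by (simp add: complex_norm_square[symmetric])
  ultimately show ?thesis by (metis mult_left_cancel pair_nonzero)
qed

lemma bse_bound_pair: "bse_bound pair T (pair x) 1"
  by (auto simp: bse_bound_def)

lemma bse_bound_one: "bse_bound pair T (\<lambda>t. 1) 1"
proof -
  have "pair 0 = (\<lambda>t. 1)" by auto
  then show ?thesis using bse_bound_pair[of T 0] by simp
qed

lemma norm_le_bse_bound:
  assumes "bse_bound pair T \<phi> B" "t \<in> T"
  shows "norm (\<phi> t) \<le> B"
  using assms(1)[unfolded bse_bound_def, rule_format, of "{t}" "\<lambda>_. 1"] assms(2) by simp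

text \<open>The coefficients \<open>c \<gamma> * pair x \<gamma>\<close> belong to the polynomial
  translated by \<open>x\<close> in the group, which has the same sup-norm. Testing
  \<open>\<phi>\<close> on all translates bounds by \<open>A\<close> the polynomial with
  coefficients \<open>c \<gamma> * \<phi> \<gamma>\<close>, and \<open>\<psi>\<close> is tested on
  that one.\<close>

lemma bse_bound_mult:
  assumes "bse_bound pair T \<phi> A" "bse_bound pair T \<psi> B"
  shows "bse_bound pair T (\<lambda>t. \<phi> t * \<psi> t) (A * B)"
  unfolding bse_bound_def
proof (intro allI impI)
  fix F c assume F: "finite F" "F \<subseteq> T" and c: "\<forall>x. norm (\<Sum>\<gamma>\<in>F. c \<gamma> * pair x \<gamma>) \<le> 1"
  have "norm (\<Sum>\<gamma>\<in>F. (c \<gamma> * \<phi> \<gamma>) * pair x \<gamma>) \<le> A" for x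
  proof -
    have "norm (\<Sum>\<gamma>\<in>F. (c \<gamma> * pair x \<gamma>) * pair y \<gamma>) \<le> 1" for y
      using c[rule_format, of "x + y"] by (simp add: pair_add_left mult.assoc)
    then have "norm (\<Sum>\<gamma>\<in>F. (c \<gamma> * pair x \<gamma>) * \<phi> \<gamma>) \<le> A"
      using assms(1)[unfolded bse_bound_def, rule_format, of F "\<lambda>\<gamma>. c \<gamma> * pair x \<gamma>"] F by simp
    then show ?thesis by (simp add: mult_ac)
  qed
  from bse_bound_scaled[OF assms(2) F this]
  show "norm (\<Sum>\<gamma>\<in>F. c \<gamma> * (\<phi> \<gamma> * \<psi> \<gamma>)) \<le> A * B" by (simp add: mult.assoc)
qed

lemma bse_bound_prod:
  assumes "finite I" "\<And>i. i \<in> I \<Longrightarrow> bse_bound pair T (f i) (C i)"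
  shows "bse_bound pair T (\<lambda>t. \<Prod>i\<in>I. f i t) (\<Prod>i\<in>I. C i)"
  using assms
proof (induction rule: finite_induct)
  case empty
  then show ?case by (simp add: bse_bound_one)
next
  case (insert i I)
  then show ?case using bse_bound_mult[of T "f i" "C i" "\<lambda>t. \<Prod>i\<in>I. f i t"] by simp
qed

text \<open>A shift of the frequencies multiplies a polynomial by a unimodular character and keeps
  its sup-norm.\<close>

lemma bse_bound_translate:
  assumes "bse_bound pair ((\<lambda>t. t - j) ` T) \<phi> B"
  shows "bse_bound pair T (\<lambda>t. \<phi> (t - j)) B"
  unfolding bse_bound_def
proof (intro allI impI)
  fix F c assume F: "finite F" "F \<subseteq> T" and c: "\<forall>x. norm (\<Sum>\<gamma>\<in>F. c \<gamma> * pair x \<gamma>) \<le> 1"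
  have re: "(\<Sum>\<gamma>\<in>(\<lambda>t. t - j) ` F. c (\<gamma> + j) * f \<gamma>) = (\<Sum>\<gamma>\<in>F. c \<gamma> * f (\<gamma> - j))"
    for f :: "'a \<Rightarrow> complex"
    by (subst sum.reindex) (auto simp: inj_on_def)
  have "norm (\<Sum>\<gamma>\<in>(\<lambda>t. t - j) ` F. c (\<gamma> + j) * pair x \<gamma>) \<le> 1" for x
  proof -
    have "(\<Sum>\<gamma>\<in>F. c \<gamma> * pair x \<gamma>) = (\<Sum>\<gamma>\<in>F. c \<gamma> * pair x (\<gamma> - j)) * pair x j"
      unfolding sum_distrib_right
      by (intro sum.cong refl) (metis diff_add_cancel mult.assoc pair_add_right)
    then show ?thesis using c[rule_format, of x] by (simp add: re norm_mult)
  qed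
  then have "norm (\<Sum>\<gamma>\<in>(\<lambda>t. t - j) ` F. c (\<gamma> + j) * \<phi> \<gamma>) \<le> B"
    using assms[unfolded bse_bound_def, rule_format, of "(\<lambda>t. t - j) ` F" "\<lambda>\<gamma>. c (\<gamma> + j)"] F
    by (simp add: image_mono)
  then show "norm (\<Sum>\<gamma>\<in>F. c \<gamma> * \<phi> (\<gamma> - j)) \<le> B" by (simp add: re)
qed

section \<open>From real parts of characters to bumps\<close>

lemma bse_bound_Re_pair:
  assumes "norm a = 1"
  shows "bse_bound pair T (\<lambda>t. of_real (Re (a * pair x t))) 1"
proof -
  have eq: "complex_of_real (Re z) = (1/2) * z + (1/2) * cnj z" for z
    by (simp add: complex_eq_iff)
  have "bse_bound pair T (\<lambda>t. ((1/2) * a) * pair x t + ((1/2) * cnj a) * pair (- x) t)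
     (norm ((1/2) * a) * 1 + norm ((1/2) * cnj a) * 1)"
    by (intro bse_bound_add bse_bound_cmult bse_bound_pair)
  then show ?thesis using assms
    by (simp only: eq pair_minus_left complex_cnj_mult mult.assoc) (simp add: norm_mult)
qed

text \<open>The iteration \<open>y \<mapsto> (w + y\<^sup>2) / 2\<close> keeps the bound \<open>1\<close> and converges to \<open>1 - sqrt (1 - w)\<close>.\<close>

lemma bse_bound_sqrt:
  assumes "bse_bound pair T (\<lambda>t. of_real (w t)) 1" "\<And>t. 0 \<le> w t" "\<And>t. w t \<le> 1"
  shows "bse_bound pair T (\<lambda>t. of_real (sqrt (1 - w t))) 2"
proof -
  define y where "y n t = ((\<lambda>u. (w t + u\<^sup>2) / 2) ^^ n) 0" for n t
  have "bse_bound pair T (\<lambda>t. of_real (y n t)) 1" for n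
  proof (induction n)
    case 0
    then show ?case using bse_bound_zero[of 1] by (simp add: y_def)
  next
    case (Suc n)
    have "bse_bound pair T (\<lambda>t. (1/2) * (of_real (w t) + of_real (y n t) * of_real (y n t)))
        (norm (1/2::complex) * (1 + 1 * 1))"
      by (intro bse_bound_cmult bse_bound_add bse_bound_mult Suc assms)
    then show ?case by (simp add: y_def power2_eq_square)
  qed
  moreover have "(\<lambda>n. y n t) \<longlonglongrightarrow> 1 - sqrt (1 - w t)" for t
    by (rule sqrt_iteration_tendsto) (use assms in \<open>auto simp: y_def\<close>)
  then have "(\<lambda>n. complex_of_real (y n t)) \<longlonglongrightarrow> of_real (1 - sqrt (1 - w t))" for t
    by (rule tendsto_of_real)
  ultimately have "bse_bound pair T (\<lambda>t. of_real (1 - sqrt (1 - w t))) 1"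
    by (rule bse_bound_lim)
  from bse_bound_diff[OF bse_bound_one this] show ?thesis by simp
qed

text \<open>Writing \<open>c = cos \<delta>\<close> and \<open>pair x t = exp (i \<theta>)\<close>, this rests on
  \<open>\<bar>cos \<theta> - cos \<delta>\<bar> = 2 \<bar>sin ((\<theta> + \<delta>) / 2)\<bar> \<bar>sin ((\<theta> - \<delta>) / 2)\<bar>\<close> and
  \<open>sin\<^sup>2 (\<alpha> / 2) = 1 - (1 + cos \<alpha>) / 2\<close>.\<close>

lemma bse_bound_abs_Re_pair:
  assumes "\<bar>c\<bar> \<le> 1"
  shows "bse_bound pair T (\<lambda>t. of_real \<bar>Re (pair x t) - c\<bar>) 8"
proof -
  \<comment> \<open>This is \<open>exp (i * \<delta>)\<close>: multiplication by \<open>a\<close>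
    and \<open>cnj a\<close> produces the angles \<open>\<theta> + \<delta>\<close> and
    \<open>\<theta> - \<delta>\<close>.\<close>
  define a where "a = Complex c (sqrt (1 - c\<^sup>2))"
  have c2: "c\<^sup>2 \<le> 1" using assms by (simp add: abs_square_le_1)
  have a: "norm a = 1" "norm (cnj a) = 1" using c2 by (auto simp: a_def cmod_def)
  have v: "bse_bound pair T (\<lambda>t. of_real (sqrt (1 - (1 + Re (b * pair x t)) / 2))) 2"
    if b: "norm b = 1" for b
  proof (rule bse_bound_sqrt)
    have "bse_bound pair T (\<lambda>t. (1/2) * (1 + of_real (Re (b * pair x t)))) (norm (1/2::complex) * (1 + 1))"
      by (intro bse_bound_cmult bse_bound_add bse_bound_one bse_bound_Re_pair b)
    then show "bse_bound pair T (\<lambda>t. of_real ((1 + Re (b * pair x t)) / 2)) 1" by simp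
    fix t
    have "\<bar>Re (b * pair x t)\<bar> \<le> 1"
      using abs_Re_le_cmod[of "b * pair x t"] b unfolding norm_mult by simp
    then show "0 \<le> (1 + Re (b * pair x t)) / 2" "(1 + Re (b * pair x t)) / 2 \<le> 1"
      by simp_all
  qed
  have eq: "\<bar>Re z - c\<bar> = 2 * (sqrt (1 - (1 + Re (a * z)) / 2) * sqrt (1 - (1 + Re (cnj a * z)) / 2))"
    if z: "norm z = 1" for z
  proof -
    have "(Re z)\<^sup>2 + (Im z)\<^sup>2 = 1" using z by (simp add: cmod_def)
    then have im: "Im z * Im z = 1 - Re z * Re z" by (simp add: power2_eq_square)
    have s: "sqrt (1 - c\<^sup>2) * sqrt (1 - c\<^sup>2) = 1 - c * c" using c2 by (simp add: power2_eq_square)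
    \<comment> \<open>The two factors multiply to \<open>(1 - c * Re z)\<^sup>2\<close> minus this
      square, divided by 4; what remains is \<open>(Re z - c)\<^sup>2 / 4\<close>.\<close>
    have "(sqrt (1 - c\<^sup>2) * Im z) * (sqrt (1 - c\<^sup>2) * Im z) = (1 - c * c) * (1 - Re z * Re z)"
      using im s by (metis mult.assoc mult.left_commute)
    then have "(1 - (1 + Re (a * z)) / 2) * (1 - (1 + Re (cnj a * z)) / 2) = ((Re z - c) / 2)\<^sup>2"
      by (simp add: a_def power2_eq_square field_simps)
    then show ?thesis by (simp add: real_sqrt_mult[symmetric] del: real_sqrt_abs) (simp add: real_sqrt_abs)
  qed
  have "bse_bound pair T (\<lambda>t. 2 * (of_real (sqrt (1 - (1 + Re (a * pair x t)) / 2)) *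
      of_real (sqrt (1 - (1 + Re (cnj a * pair x t)) / 2)))) (norm (2::complex) * (2 * 2))"
    by (intro bse_bound_cmult bse_bound_mult v a)
  then show ?thesis by (simp add: eq)
qed

lemma bse_bound_trapezoid:
  assumes "\<bar>c\<bar> \<le> 1" "\<bar>d\<bar> \<le> 1"
  shows "\<exists>C. bse_bound pair T (\<lambda>t. of_real (trapezoid c d (Re (pair x t)))) C"
proof -
  have "bse_bound pair T (\<lambda>t. of_real (1 / (2 * (d - c))) *
      ((of_real \<bar>Re (pair x t) - c\<bar> - of_real \<bar>Re (pair x t) - d\<bar>) + of_real (d - c) * 1))
      (norm (of_real (1 / (2 * (d - c))) :: complex) * ((8 + 8) + norm (of_real (d - c) :: complex) * 1))"
    by (intro bse_bound_cmult bse_bound_add bse_bound_diff bse_bound_abs_Re_pair bse_bound_one assms)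
  then have "bse_bound pair T (\<lambda>t. of_real (trapezoid c d (Re (pair x t))))
      (norm (of_real (1 / (2 * (d - c))) :: complex) * ((8 + 8) + norm (of_real (d - c) :: complex) * 1))"
    by (rule bse_bound_cong[THEN iffD1, rotated]) (simp add: trapezoid_def)
  then show ?thesis by blast
qed

text \<open>Each point of \<open>L - V\<close> is separated from 0 by some \<open>x\<close>, since
  \<open>Re (pair x \<gamma>) < 1 = Re (pair x 0)\<close>. By compactness finitely many
  \<open>x\<close> suffice, and a product of ramps in their real parts vanishes wherever one factor
  does.\<close>

lemma bump_on_compact:
  assumes "compact L" "open V" "0 \<in> V"
  shows "\<exists>h C W. continuous_on UNIV h \<and> bse_bound pair UNIV h C \<and> open W \<and> 0 \<in> W \<and>
    (\<forall>t\<in>W. h t = 1) \<and> (\<forall>t\<in>L - V. h t = 0)"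
proof -
  have "\<exists>x c. Re (pair x \<gamma>) < c \<and> \<bar>c\<bar> < 1" if "\<gamma> \<in> L - V" for \<gamma>
  proof -
    have "\<gamma> \<noteq> 0" using that assms(3) by auto
    then obtain x where x: "pair x \<gamma> \<noteq> 1" using pair_separates by blast
    have "\<bar>Re (pair x \<gamma>)\<bar> \<le> 1" using abs_Re_le_cmod[of "pair x \<gamma>"] by simp
    moreover have "Re (pair x \<gamma>) \<noteq> 1"
    proof
      assume "Re (pair x \<gamma>) = 1"
      moreover have "(Re (pair x \<gamma>))\<^sup>2 + (Im (pair x \<gamma>))\<^sup>2 = 1" using norm_pair[of x \<gamma>] by (simp add: cmod_def)
      ultimately show False using x by (simp add: complex_eq_iff)
    qed
    ultimately have "Re (pair x \<gamma>) < (1 + Re (pair x \<gamma>)) / 2" "\<bar>(1 + Re (pair x \<gamma>)) / 2\<bar> < 1" by auto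
    then show ?thesis by blast
  qed
  then obtain x c where xc: "\<And>\<gamma>. \<gamma> \<in> L - V \<Longrightarrow> Re (pair (x \<gamma>) \<gamma>) < c \<gamma> \<and> \<bar>c \<gamma>\<bar> < 1" by metis
  define O' where "O' \<gamma> = {t. Re (pair (x \<gamma>) t) < c \<gamma>}" for \<gamma>
  have "open (O' \<gamma>)" for \<gamma>
    unfolding O'_def by (intro open_Collect_less continuous_intros continuous_pair)
  moreover have "L - V \<subseteq> (\<Union>\<gamma>\<in>L - V. O' \<gamma>)" using xc by (auto simp: O'_def)
  ultimately obtain D where D: "D \<subseteq> L - V" "finite D" "L - V \<subseteq> (\<Union>\<gamma>\<in>D. O' \<gamma>)"
    by (rule compactE_image[OF compact_diff[OF assms(1,2)]])
  \<comment> \<open>Strictly between \<open>c \<gamma>\<close> and the value 1 at the origin, so the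
    ramp is constantly 1 on a neighbourhood of 0.\<close>
  define d where "d \<gamma> = (1 + c \<gamma>) / 2" for \<gamma>
  have cd: "\<bar>c \<gamma>\<bar> < 1" "\<bar>d \<gamma>\<bar> < 1" "c \<gamma> < d \<gamma>" if "\<gamma> \<in> D" for \<gamma>
    using xc[of \<gamma>] subsetD[OF D(1) that] by (auto simp: d_def)
  define \<tau> where "\<tau> \<gamma> t = complex_of_real (trapezoid (c \<gamma>) (d \<gamma>) (Re (pair (x \<gamma>) t)))" for \<gamma> t
  have "\<exists>C. bse_bound pair UNIV (\<tau> \<gamma>) C" if "\<gamma> \<in> D" for \<gamma>
    unfolding \<tau>_def using cd[OF that] by (intro bse_bound_trapezoid) auto
  then obtain C where C: "\<And>\<gamma>. \<gamma> \<in> D \<Longrightarrow> bse_bound pair UNIV (\<tau> \<gamma>) (C \<gamma>)" by metis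
  show ?thesis
  proof (intro exI conjI ballI)
    have "continuous_on UNIV (\<tau> \<gamma>)" if "\<gamma> \<in> D" for \<gamma>
      unfolding \<tau>_def trapezoid_def using cd[OF that]
      by (intro continuous_intros continuous_pair) auto
    then show "continuous_on UNIV (\<lambda>t. \<Prod>\<gamma>\<in>D. \<tau> \<gamma> t)" by (intro continuous_intros) auto
    show "bse_bound pair UNIV (\<lambda>t. \<Prod>\<gamma>\<in>D. \<tau> \<gamma> t) (\<Prod>\<gamma>\<in>D. C \<gamma>)"
      using C D(2) by (intro bse_bound_prod) auto
    show "open (\<Inter>\<gamma>\<in>D. {t. d \<gamma> < Re (pair (x \<gamma>) t)})"
      using D(2) by (intro open_INT ballI open_Collect_less continuous_intros continuous_pair) auto
    show "0 \<in> (\<Inter>\<gamma>\<in>D. {t. d \<gamma> < Re (pair (x \<gamma>) t)})" using cd by force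
    show "(\<Prod>\<gamma>\<in>D. \<tau> \<gamma> t) = 1" if "t \<in> (\<Inter>\<gamma>\<in>D. {t. d \<gamma> < Re (pair (x \<gamma>) t)})" for t
      using that cd by (intro prod.neutral) (auto simp: \<tau>_def trapezoid_upper less_imp_le)
    show "(\<Prod>\<gamma>\<in>D. \<tau> \<gamma> t) = 0" if t: "t \<in> L - V" for t
    proof -
      obtain \<gamma> where "\<gamma> \<in> D" "t \<in> O' \<gamma>" using t D(3) by blast
      then show ?thesis using D(2) cd(3)[of \<gamma>]
        by (intro prod_zero bexI[of _ \<gamma>]) (auto simp: \<tau>_def O'_def trapezoid_lower)
    qed
  qed
qed

end

locale pairing_nbhd = pairing pair for pair :: "'g::ab_group_add \<Rightarrow> 'a::topological_ab_group_add \<Rightarrow> complex" +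
  fixes V :: "'a set"
  assumes V_open: "open V" and V_zero: "0 \<in> V" and V_cpt: "compact (closure V)"
begin

abbreviation T :: "'a \<Rightarrow> 'a set" where
  "T \<gamma> \<equiv> (\<lambda>v. v + \<gamma>) ` closure V"

lemma zero_in_closure: "0 \<in> closure V"
  using V_zero closure_subset by blast

lemma mem_T_self: "\<gamma> \<in> T \<gamma>"
  using zero_in_closure by force

lemma compact_T: "compact (T \<gamma>)"
  by (intro compact_translation_group V_cpt)

text \<open>The function \<open>h\<close> of \<open>bump_on_compact\<close>, cut off outside \<open>V\<close>: each translate of \<open>closure V\<close>
  that meets \<open>V\<close> stays inside a fixed compact set on which the cut-off function agrees with \<open>h\<close>.\<close>

lemma bump:
  shows "\<exists>e C W. continuous_on UNIV e \<and> open W \<and> 0 \<in> W \<and> (\<forall>w\<in>W. - w \<in> W) \<and>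
    (\<forall>w\<in>W. e w = 1) \<and> (\<forall>t. t \<notin> V \<longrightarrow> e t = 0) \<and> (\<forall>\<gamma>. bse_bound pair (T \<gamma>) e C)"
proof -
  \<comment> \<open>If \<open>v + \<gamma>\<close> lies in \<open>V\<close>, then
    \<open>u + \<gamma> = u + (v + \<gamma>) - v\<close>; hence \<open>L\<close> contains every
    \<open>T \<gamma>\<close> that meets \<open>V\<close>.\<close>
  define L where "L = {a - b |a b. a \<in> {a + b |a b. a \<in> closure V \<and> b \<in> closure V} \<and> b \<in> closure V}"
  have L: "u + v - w \<in> L" if "u \<in> closure V" "v \<in> closure V" "w \<in> closure V" for u v w
    unfolding L_def using that by blast
  have "compact L" unfolding L_def by (rule compact_minus[OF compact_plus[OF V_cpt V_cpt] V_cpt])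
  then obtain h C W where h: "continuous_on UNIV h" "bse_bound pair UNIV h C" "open W" "0 \<in> W"
    "\<forall>t\<in>W. h t = 1" "\<forall>t\<in>L - V. h t = 0"
    using bump_on_compact[OF _ V_open V_zero] by metis
  define e where "e t = (if t \<in> V then h t else 0)" for t
  have eh: "e t = h t" if "t \<in> L" for t using that h(6) by (auto simp: e_def)
  define X where "X = W \<inter> V"
  show ?thesis
  proof (intro exI conjI ballI allI impI)
    \<comment> \<open>An open set between \<open>closure V\<close> and \<open>L\<close>. On it
      \<open>e\<close> agrees with \<open>h\<close>, on \<open>- closure V\<close> it is 0, and
      these two open sets cover the group.\<close>
    define V' where "V' = (\<Union>v\<in>closure V. (\<lambda>u. u + v) ` V)"
    have "V' \<subseteq> L"
    proof
      fix t assume "t \<in> V'"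
      then obtain u v where "u \<in> V" "v \<in> closure V" "t = u + v" by (auto simp: V'_def)
      then show "t \<in> L" using L[of u v 0] closure_subset zero_in_closure by auto
    qed
    then have "continuous_on V' e"
      using continuous_on_cong[OF refl, of V' e h] eh h(1) continuous_on_subset by blast
    moreover have "continuous_on (- closure V) e"
    proof -
      have "e t = 0" if "t \<in> - closure V" for t
        using that closure_subset[of V] by (auto simp: e_def)
      then show ?thesis using continuous_on_cong[OF refl, of "- closure V" e "\<lambda>t. 0"] by simp
    qed
    moreover have "open V'" unfolding V'_def by (intro open_UN ballI open_translation_group V_open)
    ultimately have "continuous_on (V' \<union> - closure V) e"
      by (intro continuous_on_open_Un) auto
    moreover have "closure V \<subseteq> V'" using V_zero by (force simp: V'_def)
    then have "V' \<union> - closure V = UNIV" by blast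
    ultimately show "continuous_on UNIV e" by simp
    \<comment> \<open>Symmetrised for use in \<open>separated_cover\<close>; inside \<open>V\<close>
      the cut-off leaves the value 1 of \<open>h\<close> unchanged.\<close>
    show "open (X \<inter> uminus -` X)"
      unfolding X_def by (intro open_Int open_vimage h V_open continuous_intros)
    show "0 \<in> X \<inter> uminus -` X" using h(4) V_zero by (simp add: X_def)
    show "- w \<in> X \<inter> uminus -` X" if "w \<in> X \<inter> uminus -` X" for w using that by simp
    show "e w = 1" if "w \<in> X \<inter> uminus -` X" for w using that h(5) by (simp add: X_def e_def)
    show "e t = 0" if "t \<notin> V" for t using that by (simp add: e_def)
    show "bse_bound pair (T \<gamma>) e C" for \<gamma>
    proof (cases "T \<gamma> \<inter> V = {}")
      case True
      have "bse_bound pair (T \<gamma>) (\<lambda>t. 0) C"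
        by (rule bse_bound_zero[OF bse_bound_nonneg[OF h(2)]])
      then show ?thesis
        by (rule bse_bound_cong[THEN iffD1, rotated]) (use True in \<open>auto simp: e_def\<close>)
    next
      case False
      then obtain v where v: "v \<in> closure V" "v + \<gamma> \<in> V" by blast
      have "t \<in> L" if t: "t \<in> T \<gamma>" for t
      proof -
        obtain u where "u \<in> closure V" "t = u + \<gamma>" using t by blast
        then show ?thesis using L[of u "v + \<gamma>" v] v closure_subset by (auto simp: algebra_simps)
      qed
      then have "e t = h t" if "t \<in> T \<gamma>" for t using eh that by blast
      moreover have "bse_bound pair (T \<gamma>) h C" by (rule bse_bound_mono[OF h(2)]) auto
      ultimately show ?thesis using bse_bound_cong[of "T \<gamma>" e h] by blast
    qed
  qed
qed

text \<open>With \<open>e\<close> the bump, \<open>1 - (\<Prod>j\<in>J. 1 - e (t - j))\<close> is a plateau function: if \<open>J\<close> is separated,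
  the number of factors that matter on a translate of \<open>closure V\<close> is bounded independently of \<open>J\<close>.\<close>

lemma plateau:
  shows "\<exists>C. \<forall>K. compact K \<longrightarrow> (\<exists>e Q. continuous_on UNIV e \<and> compact Q \<and>
    (\<forall>t\<in>K. e t = 1) \<and> (\<forall>t. t \<notin> Q \<longrightarrow> e t = 0) \<and> (\<forall>\<gamma>. bse_bound pair (T \<gamma>) e C))"
proof -
  obtain e C W where e: "continuous_on UNIV e" and W: "open W" "0 \<in> W" "\<And>w. w \<in> W \<Longrightarrow> - w \<in> W"
    and e1: "\<And>w. w \<in> W \<Longrightarrow> e w = 1" and e0: "\<And>t. t \<notin> V \<Longrightarrow> e t = 0"
    and eC: "\<And>\<gamma>. bse_bound pair (T \<gamma>) e C"
    using bump by metis
  have C: "0 \<le> C" using bse_bound_nonneg[OF eC] .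
  \<comment> \<open>For \<open>t\<close> in \<open>T \<gamma>\<close>, \<open>e (t - j)\<close> can
    be nonzero only if \<open>j\<close> lies in \<open>M + \<gamma>\<close>.\<close>
  define M where "M = {a - b |a b. a \<in> closure V \<and> b \<in> closure V}"
  have "compact M" unfolding M_def by (intro compact_minus V_cpt)
  then obtain N where N: "\<And>\<gamma> J. J \<subseteq> (\<lambda>v. v + \<gamma>) ` M \<Longrightarrow> pairwise (\<lambda>a b. a - b \<notin> W) J \<Longrightarrow>
      finite J \<and> card J \<le> N"
    using separated_card_bound[OF _ W(1,2)] by blast
  show ?thesis
  \<comment> \<open>At most \<open>N\<close> relevant factors, each bounded by \<open>1 + C\<close>,
    and a final subtraction from 1.\<close>
  proof (intro exI[of _ "1 + (1 + C) ^ N"] allI impI)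
    fix K :: "'a set" assume "compact K"
    then obtain J where J: "finite J" "pairwise (\<lambda>a b. a - b \<notin> W) J"
      "\<forall>k\<in>K. \<exists>j\<in>J. k - j \<in> W"
      using separated_cover[OF _ W] by blast
    define f where "f J t = (\<Prod>j\<in>J. 1 - e (t - j))" for J t
    have eJ: "continuous_on UNIV (\<lambda>t. e (t - j))" for j
      by (rule continuous_on_compose2[OF e]) (auto intro!: continuous_intros)
    have "bse_bound pair (T \<gamma>) (\<lambda>t. 1 - f J t) (1 + (1 + C) ^ N)" for \<gamma>
    proof -
      define J' where "J' = J \<inter> (\<lambda>v. v + \<gamma>) ` M"
      have J': "finite J'" "card J' \<le> N"
        using N[of J' \<gamma>] J(2) pairwise_subset[OF J(2), of J'] by (auto simp: J'_def)
      have "f J t = f J' t" if t: "t \<in> T \<gamma>" for t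
        unfolding f_def
      proof (rule prod.mono_neutral_right)
        show "\<forall>j\<in>J - J'. 1 - e (t - j) = 1"
        proof
          fix j assume j: "j \<in> J - J'"
          have "t - j \<notin> V"
          proof
            assume tj: "t - j \<in> V"
            obtain v where v: "v \<in> closure V" "t = v + \<gamma>" using t by blast
            have "v - (t - j) \<in> M" using v tj closure_subset unfolding M_def by blast
            moreover have "j = v - (t - j) + \<gamma>" using v by simp
            ultimately have "j \<in> (\<lambda>v. v + \<gamma>) ` M" by (rule rev_image_eqI)
            then show False using j by (simp add: J'_def)
          qed
          then show "1 - e (t - j) = 1" using e0 by simp
        qed
      qed (use J in \<open>auto simp: J'_def\<close>)
      then have eq: "1 - f J' t = 1 - f J t" if "t \<in> T \<gamma>" for t using that by simp
      have tr: "bse_bound pair (T \<gamma>) (\<lambda>t. e (t - j)) C" for j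
      proof (rule bse_bound_translate)
        have "(\<lambda>t. t - j) ` T \<gamma> = T (\<gamma> - j)" by (auto simp: image_image algebra_simps)
        then show "bse_bound pair ((\<lambda>t. t - j) ` T \<gamma>) e C" using eC by simp
      qed
      have "bse_bound pair (T \<gamma>) (f J') (\<Prod>j\<in>J'. 1 + C)"
        unfolding f_def by (intro bse_bound_prod J' bse_bound_diff bse_bound_one tr)
      then have "bse_bound pair (T \<gamma>) (\<lambda>t. 1 - f J' t) (1 + (\<Prod>j\<in>J'. 1 + C))"
        by (intro bse_bound_diff bse_bound_one)
      then have "bse_bound pair (T \<gamma>) (\<lambda>t. 1 - f J' t) (1 + (1 + C) ^ N)"
        by (rule bse_bound_mono) (use C J' in \<open>auto intro!: power_increasing\<close>)
      then show ?thesis by (rule bse_bound_cong[THEN iffD1, rotated]) (rule eq)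
    qed
    moreover have "continuous_on UNIV (\<lambda>t. 1 - f J t)"
      unfolding f_def by (intro continuous_intros eJ)
    moreover have "1 - f J t = 1" if t: "t \<in> K" for t
    proof -
      obtain j where "j \<in> J" "t - j \<in> W" using J(3) t by blast
      then have "f J t = 0" unfolding f_def using J(1) e1 by (intro prod_zero bexI[of _ j]) auto
      then show ?thesis by simp
    qed
    moreover have "compact (\<Union>j\<in>J. T j)" by (intro compact_UN J compact_T)
    moreover have "1 - f J t = 0" if t: "t \<notin> (\<Union>j\<in>J. T j)" for t
    proof -
      have "e (t - j) = 0" if "j \<in> J" for j
      proof (rule e0, rule notI)
        assume "t - j \<in> V"
        then have "t \<in> T j" using closure_subset by (intro image_eqI[of _ _ "t - j"]) auto
        then show False using t that by blast
      qed
      then show ?thesis by (simp add: f_def)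
    qed
    ultimately show "\<exists>e Q. continuous_on UNIV e \<and> compact Q \<and> (\<forall>t\<in>K. e t = 1) \<and>
        (\<forall>t. t \<notin> Q \<longrightarrow> e t = 0) \<and> (\<forall>\<gamma>. bse_bound pair (T \<gamma>) e (1 + (1 + C) ^ N))"
      by (intro exI[of _ "\<lambda>t. 1 - f J t"] exI[of _ "\<Union>j\<in>J. T j"] conjI ballI allI impI)
  qed
qed

section \<open>The algebra and its approximate identity\<close>

lemma C_BSE_iff:
  "\<phi> \<in> C_BSE pair (closure V) \<longleftrightarrow> continuous_on UNIV \<phi> \<and> (\<exists>B. \<forall>\<gamma>. bse_bound pair (T \<gamma>) \<phi> B)"
proof -
  have "bounded (range \<phi>)" if "\<forall>\<gamma>. bse_bound pair (T \<gamma>) \<phi> B" for B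
    unfolding bounded_iff using norm_le_bse_bound[OF that[rule_format] mem_T_self] by auto
  then show ?thesis unfolding C_BSE_def Cb_def mem_Collect_eq bse_norm_finite_iff by blast
qed

lemma KGamma_superset:
  fixes K :: "'a set"
  assumes "compact K"
  shows "\<exists>\<Omega>\<in>KGamma. K \<subseteq> \<Omega>"
proof -
  have "K \<subseteq> (\<Union>k\<in>K. (\<lambda>v. v + k) ` V)" using V_zero by force
  then obtain D where D: "finite D" "K \<subseteq> (\<Union>k\<in>D. (\<lambda>v. v + k) ` V)"
    using compactE_image[OF assms, of K "\<lambda>k. (\<lambda>v. v + k) ` V"] open_translation_group[OF V_open]
    by metis
  \<comment> \<open>Inserting 0 keeps the interior nonempty when \<open>K\<close> is empty.\<close>
  define O' where "O' = (\<Union>k\<in>insert 0 D. (\<lambda>v. v + k) ` V)"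
  define \<Omega> where "\<Omega> = (\<Union>k\<in>insert 0 D. T k)"
  have "O' \<subseteq> \<Omega>" unfolding O'_def \<Omega>_def using closure_subset by fast
  moreover have "open O'" unfolding O'_def by (intro open_UN ballI open_translation_group V_open)
  ultimately have O': "O' \<subseteq> interior \<Omega>" by (rule interior_maximal)
  have "T k \<subseteq> closure (interior \<Omega>)" if k: "k \<in> insert 0 D" for k
  proof (rule image_closure_subset)
    show "continuous_on (closure V) (\<lambda>v. v + k)" by (intro continuous_intros)
    have "(\<lambda>v. v + k) ` V \<subseteq> O'" unfolding O'_def using k by blast
    then show "(\<lambda>v. v + k) ` V \<subseteq> closure (interior \<Omega>)" using O' closure_subset by blast
  qed simp
  then have "\<Omega> \<subseteq> closure (interior \<Omega>)" unfolding \<Omega>_def by blast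
  moreover have "compact \<Omega>" unfolding \<Omega>_def by (intro compact_UN compact_T) (simp add: D)
  moreover have "0 \<in> O'" using V_zero by (auto simp: O'_def)
  ultimately have "\<Omega> \<in> KGamma" using O' unfolding KGamma_def by blast
  moreover have "K \<subseteq> \<Omega>" using D(2) \<open>O' \<subseteq> \<Omega>\<close> unfolding O'_def by blast
  ultimately show ?thesis by blast
qed

text \<open>By \<open>KGamma_superset\<close> the family \<open>KGamma\<close> is cofinal among
  compact sets, so the limit along it means smallness off some compact set.\<close>

lemma A_alg_iff:
  "\<psi> \<in> A_alg pair (closure V) \<longleftrightarrow> \<psi> \<in> C_BSE pair (closure V) \<and>
     (\<forall>\<epsilon>>0. \<exists>K. compact K \<and> (\<forall>\<gamma>. \<gamma> \<notin> K \<longrightarrow> bse_bound pair (T \<gamma>) \<psi> \<epsilon>))"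
  (is "_ \<longleftrightarrow> _ \<and> ?vanish")
proof -
  have sup: "(SUP \<gamma>\<in>-\<Omega>. bse_loc pair (closure V) \<psi> \<gamma>) \<le> ereal \<epsilon> \<longleftrightarrow>
      (\<forall>\<gamma>. \<gamma> \<notin> \<Omega> \<longrightarrow> bse_bound pair (T \<gamma>) \<psi> \<epsilon>)" for \<Omega> \<epsilon>
    by (auto simp: SUP_le_iff bse_loc_le_iff)
  have "?vanish \<longleftrightarrow> (\<forall>\<epsilon>>0. \<exists>\<Omega>0\<in>KGamma. \<forall>\<Omega>\<in>KGamma. \<Omega>0 \<subseteq> \<Omega> \<longrightarrow>
      (\<forall>\<gamma>. \<gamma> \<notin> \<Omega> \<longrightarrow> bse_bound pair (T \<gamma>) \<psi> \<epsilon>))" (is "_ \<longleftrightarrow> ?lim")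
  proof
    assume v: ?vanish
    show ?lim
    proof (intro allI impI)
      fix \<epsilon> :: real assume "0 < \<epsilon>"
      then obtain K where K: "compact K" "\<forall>\<gamma>. \<gamma> \<notin> K \<longrightarrow> bse_bound pair (T \<gamma>) \<psi> \<epsilon>" using v by blast
      obtain \<Omega>0 where "\<Omega>0 \<in> KGamma" "K \<subseteq> \<Omega>0" using KGamma_superset[OF K(1)] by blast
      then show "\<exists>\<Omega>0\<in>KGamma. \<forall>\<Omega>\<in>KGamma. \<Omega>0 \<subseteq> \<Omega> \<longrightarrow>
          (\<forall>\<gamma>. \<gamma> \<notin> \<Omega> \<longrightarrow> bse_bound pair (T \<gamma>) \<psi> \<epsilon>)"
        using K(2) by blast
    qed
  next
    assume l: ?lim
    show ?vanish
    proof (intro allI impI)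
      fix \<epsilon> :: real assume "0 < \<epsilon>"
      from l[THEN spec, THEN mp, OF this] obtain \<Omega>0 where \<Omega>0: "\<Omega>0 \<in> KGamma"
        and *: "\<forall>\<Omega>\<in>KGamma. \<Omega>0 \<subseteq> \<Omega> \<longrightarrow> (\<forall>\<gamma>. \<gamma> \<notin> \<Omega> \<longrightarrow> bse_bound pair (T \<gamma>) \<psi> \<epsilon>)"
        by (rule bexE)
      have "\<forall>\<gamma>. \<gamma> \<notin> \<Omega>0 \<longrightarrow> bse_bound pair (T \<gamma>) \<psi> \<epsilon>"
        by (rule *[THEN bspec, OF \<Omega>0, THEN mp, OF order_refl])
      with \<Omega>0 show "\<exists>K. compact K \<and> (\<forall>\<gamma>. \<gamma> \<notin> K \<longrightarrow> bse_bound pair (T \<gamma>) \<psi> \<epsilon>)"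
        by (intro exI[of _ \<Omega>0]) (auto simp: KGamma_def)
    qed
  qed
  then show ?thesis unfolding A_alg_def mem_Collect_eq sup by simp
qed

text \<open>Makes \<open>\<phi> * e\<close> available to the ideal property of \<open>S\<close> for
  a \<open>\<phi>\<close> that need not lie in the algebra.\<close>

lemma A_alg_mult:
  assumes "\<phi> \<in> C_BSE pair (closure V)" "\<psi> \<in> A_alg pair (closure V)"
  shows "(\<lambda>t. \<phi> t * \<psi> t) \<in> A_alg pair (closure V)"
proof -
  obtain A where A: "\<And>\<gamma>. bse_bound pair (T \<gamma>) \<phi> A" using assms(1) C_BSE_iff by blast
  obtain B where B: "\<And>\<gamma>. bse_bound pair (T \<gamma>) \<psi> B" using assms(2) A_alg_iff C_BSE_iff by blast
  have "0 \<le> A" using bse_bound_nonneg[OF A] .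
  have "\<exists>K. compact K \<and> (\<forall>\<gamma>. \<gamma> \<notin> K \<longrightarrow> bse_bound pair (T \<gamma>) (\<lambda>t. \<phi> t * \<psi> t) \<epsilon>)"
    if "0 < \<epsilon>" for \<epsilon>
  proof -
    have "0 < \<epsilon> / (A + 1)" using that \<open>0 \<le> A\<close> by simp
    then obtain K where K: "compact K" "\<forall>\<gamma>. \<gamma> \<notin> K \<longrightarrow> bse_bound pair (T \<gamma>) \<psi> (\<epsilon> / (A + 1))"
      using assms(2) A_alg_iff by blast
    have "A * (\<epsilon> / (A + 1)) \<le> \<epsilon>" using that \<open>0 \<le> A\<close> by (simp add: field_simps)
    then have "bse_bound pair (T \<gamma>) (\<lambda>t. \<phi> t * \<psi> t) \<epsilon>" if "\<gamma> \<notin> K" for \<gamma>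
      using bse_bound_mono[OF bse_bound_mult[OF A K(2)[rule_format, OF that]] order_refl] by simp
    then show ?thesis using K(1) by blast
  qed
  moreover have "(\<lambda>t. \<phi> t * \<psi> t) \<in> C_BSE pair (closure V)"
    unfolding C_BSE_iff
  proof (intro conjI exI allI)
    show "continuous_on UNIV (\<lambda>t. \<phi> t * \<psi> t)"
      using assms A_alg_iff C_BSE_iff by (intro continuous_intros) blast+
    show "bse_bound pair (T \<gamma>) (\<lambda>t. \<phi> t * \<psi> t) (A * B)" for \<gamma> by (rule bse_bound_mult[OF A B])
  qed
  ultimately show ?thesis by (simp add: A_alg_iff)
qed

lemma A_alg_diff:
  assumes "\<phi> \<in> A_alg pair (closure V)" "\<psi> \<in> A_alg pair (closure V)"
  shows "(\<lambda>t. \<phi> t - \<psi> t) \<in> A_alg pair (closure V)"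
proof -
  obtain A where A: "\<And>\<gamma>. bse_bound pair (T \<gamma>) \<phi> A" using assms(1) A_alg_iff C_BSE_iff by blast
  obtain B where B: "\<And>\<gamma>. bse_bound pair (T \<gamma>) \<psi> B" using assms(2) A_alg_iff C_BSE_iff by blast
  have "\<exists>K. compact K \<and> (\<forall>\<gamma>. \<gamma> \<notin> K \<longrightarrow> bse_bound pair (T \<gamma>) (\<lambda>t. \<phi> t - \<psi> t) \<epsilon>)"
    if "0 < \<epsilon>" for \<epsilon>
  proof -
    have "0 < \<epsilon> / 2" using that by simp
    then obtain K L where K: "compact K" "\<forall>\<gamma>. \<gamma> \<notin> K \<longrightarrow> bse_bound pair (T \<gamma>) \<phi> (\<epsilon> / 2)"
      and L: "compact L" "\<forall>\<gamma>. \<gamma> \<notin> L \<longrightarrow> bse_bound pair (T \<gamma>) \<psi> (\<epsilon> / 2)"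
      using assms A_alg_iff by meson
    have "bse_bound pair (T \<gamma>) (\<lambda>t. \<phi> t - \<psi> t) \<epsilon>" if "\<gamma> \<notin> K \<union> L" for \<gamma>
      using bse_bound_diff[of pair "T \<gamma>" \<phi> "\<epsilon> / 2" \<psi> "\<epsilon> / 2"] K(2) L(2) that by simp
    then show ?thesis using compact_Un[OF K(1) L(1)] by blast
  qed
  moreover have "(\<lambda>t. \<phi> t - \<psi> t) \<in> C_BSE pair (closure V)"
    unfolding C_BSE_iff
  proof (intro conjI exI allI)
    show "continuous_on UNIV (\<lambda>t. \<phi> t - \<psi> t)"
      using assms A_alg_iff C_BSE_iff by (intro continuous_intros) blast+
    show "bse_bound pair (T \<gamma>) (\<lambda>t. \<phi> t - \<psi> t) (A + B)" for \<gamma> by (rule bse_bound_diff[OF A B])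
  qed
  ultimately show ?thesis by (simp add: A_alg_iff)
qed

text \<open>\<open>T \<gamma>\<close> meets \<open>Q\<close> only for \<open>\<gamma>\<close> in the
  compact set \<open>Q - closure V\<close>; elsewhere the local norm is 0.\<close>

lemma compact_support_A_alg:
  assumes "\<phi> \<in> C_BSE pair (closure V)" "compact Q" "\<And>t. t \<notin> Q \<Longrightarrow> \<phi> t = 0"
  shows "\<phi> \<in> A_alg pair (closure V)"
proof -
  define K where "K = {q - v |q v. q \<in> Q \<and> v \<in> closure V}"
  have "compact K" unfolding K_def by (rule compact_minus[OF assms(2) V_cpt])
  moreover have "bse_bound pair (T \<gamma>) \<phi> \<epsilon>" if \<gamma>: "\<gamma> \<notin> K" and "0 < \<epsilon>" for \<gamma> \<epsilon>
  proof -
    have "0 = \<phi> t" if t: "t \<in> T \<gamma>" for t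
    proof -
      obtain v where v: "v \<in> closure V" "t = v + \<gamma>" using t by blast
      have "t \<notin> Q"
      proof
        assume "t \<in> Q"
        then have "t - v \<in> K" using v(1) unfolding K_def by blast
        then show False using \<gamma> v(2) by simp
      qed
      then show ?thesis using assms(3) by simp
    qed
    moreover have "bse_bound pair (T \<gamma>) (\<lambda>t. 0) \<epsilon>"
      by (rule bse_bound_zero[OF less_imp_le[OF \<open>0 < \<epsilon>\<close>]])
    ultimately show ?thesis by (rule bse_bound_cong[THEN iffD1])
  qed
  ultimately show ?thesis using assms(1) A_alg_iff by blast
qed

lemma plateau_A_alg:
  shows "\<exists>C\<ge>0. \<forall>K. compact K \<longrightarrow> (\<exists>e Q. e \<in> A_alg pair (closure V) \<and> compact Q \<and>
    (\<forall>t\<in>K. e t = 1) \<and> (\<forall>t. t \<notin> Q \<longrightarrow> e t = 0) \<and> (\<forall>\<gamma>. bse_bound pair (T \<gamma>) e C))"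
proof -
  obtain C where C: "\<And>K. compact K \<Longrightarrow> \<exists>e Q. continuous_on UNIV e \<and> compact Q \<and>
    (\<forall>t\<in>K. e t = 1) \<and> (\<forall>t. t \<notin> Q \<longrightarrow> e t = 0) \<and> (\<forall>\<gamma>. bse_bound pair (T \<gamma>) e C)"
    using plateau by blast
  have "0 \<le> C" using C[OF compact_empty] bse_bound_nonneg by blast
  moreover have "\<exists>e Q. e \<in> A_alg pair (closure V) \<and> compact Q \<and> (\<forall>t\<in>K. e t = 1) \<and>
      (\<forall>t. t \<notin> Q \<longrightarrow> e t = 0) \<and> (\<forall>\<gamma>. bse_bound pair (T \<gamma>) e C)" if K: "compact K" for K
  proof -
    obtain e Q where e: "continuous_on UNIV e" "compact Q" "\<forall>t\<in>K. e t = 1"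
      "\<forall>t. t \<notin> Q \<longrightarrow> e t = 0" "\<forall>\<gamma>. bse_bound pair (T \<gamma>) e C"
      using C[OF K] by blast
    have "e \<in> C_BSE pair (closure V)" using e(1,5) C_BSE_iff by blast
    then have "e \<in> A_alg pair (closure V)" using compact_support_A_alg e(2,4) by blast
    then show ?thesis using e by blast
  qed
  ultimately show ?thesis by blast
qed

text \<open>Choose \<open>K\<close> off which \<open>u\<close> is locally small, and
  \<open>e\<close> equal to 1 on \<open>closure V + K\<close>. Then \<open>u - e * u\<close>
  vanishes on \<open>T \<gamma>\<close> for \<open>\<gamma>\<close> in \<open>K\<close>, and
  elsewhere the bound \<open>1 + C\<close> of \<open>1 - e\<close> meets the smallness of
  \<open>u\<close>.\<close>

lemma A_alg_bounded_approximate_identity: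
  shows "\<exists>C\<ge>0. \<forall>u\<in>A_alg pair (closure V). \<forall>\<epsilon>>0. \<exists>e\<in>A_alg pair (closure V).
    (\<forall>\<gamma>. bse_bound pair (T \<gamma>) e C) \<and> (\<forall>\<gamma>. bse_bound pair (T \<gamma>) (\<lambda>t. u t - e t * u t) \<epsilon>)"
proof -
  obtain C where "0 \<le> C" and C: "\<And>K. compact K \<Longrightarrow> \<exists>e Q. e \<in> A_alg pair (closure V) \<and> compact Q \<and>
    (\<forall>t\<in>K. e t = 1) \<and> (\<forall>t. t \<notin> Q \<longrightarrow> e t = 0) \<and> (\<forall>\<gamma>. bse_bound pair (T \<gamma>) e C)"
    using plateau_A_alg by blast
  have "\<exists>e\<in>A_alg pair (closure V). (\<forall>\<gamma>. bse_bound pair (T \<gamma>) e C) \<and>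
      (\<forall>\<gamma>. bse_bound pair (T \<gamma>) (\<lambda>t. u t - e t * u t) \<epsilon>)"
    if u: "u \<in> A_alg pair (closure V)" and "0 < \<epsilon>" for u \<epsilon>
  proof -
    have "0 < \<epsilon> / (1 + C)" using \<open>0 < \<epsilon>\<close> \<open>0 \<le> C\<close> by simp
    then obtain K where K: "compact K" "\<forall>\<gamma>. \<gamma> \<notin> K \<longrightarrow> bse_bound pair (T \<gamma>) u (\<epsilon> / (1 + C))"
      using u A_alg_iff by blast
    obtain e where e: "e \<in> A_alg pair (closure V)" "\<forall>t\<in>{v + k |v k. v \<in> closure V \<and> k \<in> K}. e t = 1"
      "\<forall>\<gamma>. bse_bound pair (T \<gamma>) e C"
      using C[OF compact_plus[OF V_cpt K(1)]] by blast
    have "bse_bound pair (T \<gamma>) (\<lambda>t. u t - e t * u t) \<epsilon>" for \<gamma>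
    proof (cases "\<gamma> \<in> K")
      case True
      have "0 = u t - e t * u t" if "t \<in> T \<gamma>" for t
      proof -
        have "t \<in> {v + k |v k. v \<in> closure V \<and> k \<in> K}" using that True by blast
        then show ?thesis using e(2) by simp
      qed
      moreover have "bse_bound pair (T \<gamma>) (\<lambda>t. 0) \<epsilon>"
        by (rule bse_bound_zero[OF less_imp_le[OF \<open>0 < \<epsilon>\<close>]])
      ultimately show ?thesis by (rule bse_bound_cong[THEN iffD1])
    next
      case False
      have "bse_bound pair (T \<gamma>) (\<lambda>t. (1 - e t) * u t) ((1 + C) * (\<epsilon> / (1 + C)))"
        by (intro bse_bound_mult bse_bound_diff bse_bound_one e(3)[rule_format] K(2)[rule_format] False)
      moreover have "(\<lambda>t. (1 - e t) * u t) = (\<lambda>t. u t - e t * u t)" by (simp add: algebra_simps)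
      ultimately show ?thesis using \<open>0 \<le> C\<close> by simp
    qed
    then show ?thesis using e by blast
  qed
  then show ?thesis using \<open>0 \<le> C\<close> by blast
qed

end

section \<open>Segal algebras and their multipliers\<close>

locale segal_alg = pairing_nbhd pair V
  for pair :: "'g::ab_group_add \<Rightarrow> 'a::topological_ab_group_add \<Rightarrow> complex" and V +
  fixes S :: "('a \<Rightarrow> complex) set" and nS :: "('a \<Rightarrow> complex) \<Rightarrow> real"
  assumes segal: "segal_algebra pair (closure V) S nS"
begin

lemma
  shows S_A_alg: "\<phi> \<in> S \<Longrightarrow> \<phi> \<in> A_alg pair (closure V)"
    and S_zero: "(\<lambda>t. 0) \<in> S"
    and S_add: "\<phi> \<in> S \<Longrightarrow> \<psi> \<in> S \<Longrightarrow> (\<lambda>t. \<phi> t + \<psi> t) \<in> S"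
    and S_scale: "\<phi> \<in> S \<Longrightarrow> (\<lambda>t. a * \<phi> t) \<in> S"
    and S_ideal: "\<phi> \<in> S \<Longrightarrow> \<psi> \<in> A_alg pair (closure V) \<Longrightarrow> (\<lambda>t. \<phi> t * \<psi> t) \<in> S"
    and nS_nonneg: "\<phi> \<in> S \<Longrightarrow> 0 \<le> nS \<phi>"
    and nS_triangle: "\<phi> \<in> S \<Longrightarrow> \<psi> \<in> S \<Longrightarrow> nS (\<lambda>t. \<phi> t + \<psi> t) \<le> nS \<phi> + nS \<psi>"
    and nS_scale: "\<phi> \<in> S \<Longrightarrow> nS (\<lambda>t. a * \<phi> t) = norm a * nS \<phi>"
  using segal unfolding segal_algebra_def by auto

lemma S_dense:
  assumes "\<psi> \<in> A_alg pair (closure V)" "0 < \<epsilon>"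
  shows "\<exists>\<phi>\<in>S. \<forall>\<gamma>. bse_bound pair (T \<gamma>) (\<lambda>t. \<psi> t - \<phi> t) \<epsilon>"
proof -
  have "\<forall>\<psi>\<in>A_alg pair (closure V). \<forall>\<epsilon>>0. \<exists>\<phi>\<in>S. bse_norm pair (closure V) (\<lambda>t. \<psi> t - \<phi> t) < ereal \<epsilon>"
    using segal unfolding segal_algebra_def by (elim conjE)
  then obtain \<phi> where "\<phi> \<in> S" "bse_norm pair (closure V) (\<lambda>t. \<psi> t - \<phi> t) < ereal \<epsilon>"
    using assms by blast
  then show ?thesis using bse_norm_le_iff[of pair "closure V" "\<lambda>t. \<psi> t - \<phi> t" \<epsilon>] less_imp_le by blast
qed

lemma S_complete:
  assumes "\<And>n. f n \<in> S" "\<And>\<epsilon>. 0 < \<epsilon> \<Longrightarrow> \<exists>N. \<forall>m\<ge>N. \<forall>n\<ge>N. nS (\<lambda>t. f m t - f n t) < \<epsilon>"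
  shows "\<exists>\<phi>\<in>S. (\<lambda>n::nat. nS (\<lambda>t. f n t - \<phi> t)) \<longlonglongrightarrow> 0"
proof -
  have "\<forall>f::nat \<Rightarrow> ('a \<Rightarrow> complex). (\<forall>n. f n \<in> S) \<longrightarrow>
        (\<forall>\<epsilon>>0. \<exists>N. \<forall>m\<ge>N. \<forall>n\<ge>N. nS (\<lambda>t. f m t - f n t) < \<epsilon>) \<longrightarrow>
        (\<exists>\<phi>\<in>S. (\<lambda>n. nS (\<lambda>t. f n t - \<phi> t)) \<longlonglongrightarrow> 0)"
    using segal unfolding segal_algebra_def by (elim conjE)
  from this[rule_format, of f] assms show ?thesis by simp
qed

lemma bse_bound_nS:
  assumes "\<phi> \<in> S"
  shows "bse_bound pair (T \<gamma>) \<phi> (nS \<phi>)"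
proof -
  have "\<forall>\<phi>\<in>S. bse_norm pair (closure V) \<phi> \<le> ereal (nS \<phi>)"
    using segal unfolding segal_algebra_def by (elim conjE)
  then show ?thesis using assms bse_norm_le_iff by blast
qed

lemma norm_le_nS: "\<phi> \<in> S \<Longrightarrow> norm (\<phi> t) \<le> nS \<phi>"
  using norm_le_bse_bound[OF bse_bound_nS mem_T_self] .

lemma nS_mult:
  assumes "\<phi> \<in> S" "\<psi> \<in> A_alg pair (closure V)" "\<And>\<gamma>. bse_bound pair (T \<gamma>) \<psi> B"
  shows "nS (\<lambda>t. \<phi> t * \<psi> t) \<le> nS \<phi> * B"
proof -
  have "\<forall>\<phi>\<in>S. \<forall>\<psi>\<in>A_alg pair (closure V).
      ereal (nS (\<lambda>t. \<phi> t * \<psi> t)) \<le> ereal (nS \<phi>) * bse_norm pair (closure V) \<psi>"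
    using segal unfolding segal_algebra_def by (elim conjE)
  then have "ereal (nS (\<lambda>t. \<phi> t * \<psi> t)) \<le> ereal (nS \<phi>) * bse_norm pair (closure V) \<psi>"
    using assms by blast
  also have "\<dots> \<le> ereal (nS \<phi>) * ereal B"
    using assms(1,3) nS_nonneg by (intro ereal_mult_left_mono) (auto simp: bse_norm_le_iff)
  finally show ?thesis by simp
qed

lemma S_approximate_unit:
  assumes "\<phi> \<in> S" "0 < \<epsilon>"
  shows "\<exists>u\<in>S. nS (\<lambda>t. \<phi> t - u t * \<phi> t) < \<epsilon>"
proof -
  have "\<forall>\<phi>\<in>S. \<forall>\<epsilon>>0. \<exists>u\<in>S. nS (\<lambda>t. \<phi> t - u t * \<phi> t) < \<epsilon>"
    using segal unfolding segal_algebra_def by (elim conjE)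
  then show ?thesis using assms by blast
qed

section \<open>Completeness of \<open>S\<close> and geometric convergence\<close>

lemma S_diff: "\<phi> \<in> S \<Longrightarrow> \<psi> \<in> S \<Longrightarrow> (\<lambda>t. \<phi> t - \<psi> t) \<in> S"
  using S_add[OF _ S_scale[of \<psi> "-1"]] by simp

lemma nS_triangle_diff: "\<phi> \<in> S \<Longrightarrow> \<psi> \<in> S \<Longrightarrow> nS (\<lambda>t. \<phi> t - \<psi> t) \<le> nS \<phi> + nS \<psi>"
  using nS_triangle[OF _ S_scale[of \<psi> "-1"]] nS_scale[of \<psi> "-1"] by simp

lemma nS_diff_commute:
  assumes "\<phi> \<in> S" "\<psi> \<in> S"
  shows "nS (\<lambda>t. \<phi> t - \<psi> t) = nS (\<lambda>t. \<psi> t - \<phi> t)"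
  using nS_scale[OF S_diff[OF assms], of "-1"] by simp

text \<open>The sequence is Cauchy in \<open>nS\<close>; convergence in \<open>nS\<close> forces
  pointwise convergence because \<open>nS\<close> dominates all values.\<close>

lemma S_geometric_limit:
  assumes s: "\<And>n. s n \<in> S" and d: "\<And>n. nS (\<lambda>t. s (Suc n) t - s n t) \<le> C * (1/2) ^ n"
  shows "\<exists>f\<in>S. \<forall>t. (\<lambda>n. s n t) \<longlonglongrightarrow> f t"
proof -
  \<comment> \<open>The right side is the exact value of the geometric sum, which closes the
    induction.\<close>
  have tail: "nS (\<lambda>t. s (n + k) t - s n t) \<le> 2 * C * ((1/2) ^ n - (1/2) ^ (n + k))" for n k
  proof (induction k)
    case 0
    then show ?case using nS_scale[OF S_zero, of 0] by simp
  next
    case (Suc k)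
    have "nS (\<lambda>t. (s (Suc (n + k)) t - s (n + k) t) + (s (n + k) t - s n t))
        \<le> C * (1/2) ^ (n + k) + 2 * C * ((1/2) ^ n - (1/2) ^ (n + k))"
      using nS_triangle[OF S_diff[OF s s] S_diff[OF s s], of "Suc (n + k)" "n + k" "n + k" n] d[of "n + k"] Suc
      by linarith
    then show ?case by (simp add: algebra_simps)
  qed
  have "0 \<le> C" using d[of 0] nS_nonneg[OF S_diff[OF s s], of "Suc 0" 0] by simp
  then have tail': "nS (\<lambda>t. s m t - s n t) \<le> 2 * C * (1/2) ^ n" if "n \<le> m" for m n
  proof -
    have "2 * C * ((1/2) ^ n - (1/2) ^ m) \<le> 2 * C * (1/2) ^ n"
      using \<open>0 \<le> C\<close> by (intro mult_left_mono) auto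
    then show ?thesis using tail[of n "m - n"] that by simp
  qed
  have "\<exists>f\<in>S. (\<lambda>n. nS (\<lambda>t. s n t - f t)) \<longlonglongrightarrow> 0"
  proof (rule S_complete[OF s])
    fix \<epsilon> :: real assume "0 < \<epsilon>"
    have "(\<lambda>n. 2 * C * (1/2) ^ n) \<longlonglongrightarrow> 2 * C * 0"
      by (intro tendsto_mult_left LIMSEQ_power_zero) simp
    then have "\<forall>\<^sub>F n in sequentially. 2 * C * (1/2) ^ n < \<epsilon>"
      using \<open>0 < \<epsilon>\<close> by (intro order_tendstoD(2)) auto
    then obtain N where N: "\<And>n. n \<ge> N \<Longrightarrow> 2 * C * (1/2) ^ n < \<epsilon>"
      unfolding eventually_sequentially by blast
    have "nS (\<lambda>t. s m t - s n t) < \<epsilon>" if "m \<ge> N" "n \<ge> N" for m n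
    proof (cases "n \<le> m")
      case True
      then show ?thesis using tail'[of n m] N[of n] that by linarith
    next
      case False
      then show ?thesis using tail'[of m n] N[of m] that nS_diff_commute[OF s s, of m n] by simp
    qed
    then show "\<exists>N. \<forall>m\<ge>N. \<forall>n\<ge>N. nS (\<lambda>t. s m t - s n t) < \<epsilon>" by blast
  qed
  then obtain f where f: "f \<in> S" "(\<lambda>n. nS (\<lambda>t. s n t - f t)) \<longlonglongrightarrow> 0" by blast
  have "(\<lambda>n. s n t) \<longlonglongrightarrow> f t" for t
  proof -
    have "(\<lambda>n. s n t - f t) \<longlonglongrightarrow> 0"
      by (rule Lim_null_comparison[OF _ f(2)])
         (intro always_eventually allI norm_le_nS[OF S_diff[OF s f(1)]])
    then show ?thesis by (simp add: LIM_zero_iff)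
  qed
  then show ?thesis using f(1) by blast
qed

text \<open>The form in which completeness is used: a known pointwise limit is identified with the
  limit in \<open>S\<close>.\<close>

lemma S_limit_mem:
  assumes "\<And>n. s n \<in> S" "\<And>n. nS (\<lambda>t. s (Suc n) t - s n t) \<le> C * (1/2) ^ n"
    and lim: "\<And>t. (\<lambda>n. s n t) \<longlonglongrightarrow> g t"
  shows "g \<in> S"
proof -
  obtain f where f: "f \<in> S" "\<And>t. (\<lambda>n. s n t) \<longlonglongrightarrow> f t"
    using S_geometric_limit[of s C] assms(1,2) by blast
  have "f = g" using LIMSEQ_unique[OF f(2) lim] by auto
  then show ?thesis using f(1) by simp
qed

text \<open>If \<open>u * g\<close> is close to \<open>g\<close> in \<open>nS\<close> and
  \<open>e * u\<close> is close to \<open>u\<close> in the algebra norm, then \<open>e * g\<close>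
  is close to \<open>g\<close>: with \<open>r = g - u * g\<close>, the error is
  \<open>(r - r * e) + g * (u - e * u)\<close>. Only the bound of \<open>e\<close> enters, not that
  of \<open>u\<close>.\<close>

lemma S_bounded_approximate_unit:
  "\<exists>C. \<forall>g\<in>S. \<forall>\<epsilon>>0. \<exists>e\<in>A_alg pair (closure V).
     (\<forall>\<gamma>. bse_bound pair (T \<gamma>) e C) \<and> nS (\<lambda>t. g t - e t * g t) < \<epsilon>"
proof -
  obtain C where "0 \<le> C" and C: "\<And>u \<epsilon>. u \<in> A_alg pair (closure V) \<Longrightarrow> 0 < \<epsilon> \<Longrightarrow>
    \<exists>e\<in>A_alg pair (closure V). (\<forall>\<gamma>. bse_bound pair (T \<gamma>) e C) \<and>
      (\<forall>\<gamma>. bse_bound pair (T \<gamma>) (\<lambda>t. u t - e t * u t) \<epsilon>)"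
    using A_alg_bounded_approximate_identity by blast
  have "\<exists>e\<in>A_alg pair (closure V). (\<forall>\<gamma>. bse_bound pair (T \<gamma>) e C) \<and> nS (\<lambda>t. g t - e t * g t) < \<epsilon>"
    if g: "g \<in> S" and "0 < \<epsilon>" for g \<epsilon>
  proof -
    \<comment> \<open>Both summands of the error are to stay within \<open>\<epsilon> / 2\<close>:
      the first costs \<open>nS r * (1 + C)\<close>, the second
      \<open>nS g * \<eta>\<close>.\<close>
    define \<delta> where "\<delta> = \<epsilon> / (2 * (1 + C))"
    define \<eta> where "\<eta> = \<epsilon> / (2 * (1 + nS g))"
    have pos: "0 < \<delta>" "0 < \<eta>" using \<open>0 < \<epsilon>\<close> \<open>0 \<le> C\<close> nS_nonneg[OF g] by (auto simp: \<delta>_def \<eta>_def)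
    obtain u where u: "u \<in> S" "nS (\<lambda>t. g t - u t * g t) < \<delta>"
      using S_approximate_unit[OF g pos(1)] by blast
    obtain e where e: "e \<in> A_alg pair (closure V)" "\<forall>\<gamma>. bse_bound pair (T \<gamma>) e C"
      "\<forall>\<gamma>. bse_bound pair (T \<gamma>) (\<lambda>t. u t - e t * u t) \<eta>"
      using C[OF S_A_alg[OF u(1)] pos(2)] by blast
    define r where "r t = g t - u t * g t" for t
    have ug: "(\<lambda>t. g t * u t) \<in> S" by (rule S_ideal[OF g S_A_alg[OF u(1)]])
    have r: "r \<in> S" unfolding r_def using S_diff[OF g ug] by (simp add: mult.commute)
    have re: "(\<lambda>t. r t * e t) \<in> S" by (rule S_ideal[OF r e(1)])
    have "(\<lambda>t. e t * u t) \<in> A_alg pair (closure V)"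
      using A_alg_mult[OF _ S_A_alg[OF u(1)]] e(1) A_alg_iff by blast
    then have ue: "(\<lambda>t. u t - e t * u t) \<in> A_alg pair (closure V)"
      by (rule A_alg_diff[OF S_A_alg[OF u(1)]])
    have gue: "(\<lambda>t. g t * (u t - e t * u t)) \<in> S" by (rule S_ideal[OF g ue])
    have eq: "(\<lambda>t. g t - e t * g t) = (\<lambda>t. (r t - r t * e t) + g t * (u t - e t * u t))"
      by (simp add: r_def algebra_simps)
    have "nS (\<lambda>t. g t - e t * g t) \<le> nS (\<lambda>t. r t - r t * e t) + nS (\<lambda>t. g t * (u t - e t * u t))"
      unfolding eq by (rule nS_triangle[OF S_diff[OF r re] gue])
    also have "nS (\<lambda>t. r t - r t * e t) \<le> nS r + nS r * C"
      using nS_triangle_diff[OF r re] nS_mult[OF r e(1), of C] e(2) by simp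
    also have "nS r + nS r * C \<le> \<delta> * (1 + C)"
      using u(2) \<open>0 \<le> C\<close> mult_right_mono[of "nS r" \<delta> "1 + C"] by (simp add: r_def[abs_def] distrib_left)
    also have "\<delta> * (1 + C) = \<epsilon> / 2" using \<open>0 \<le> C\<close> by (simp add: \<delta>_def field_simps)
    also have "nS (\<lambda>t. g t * (u t - e t * u t)) \<le> nS g * \<eta>"
      by (rule nS_mult[OF g ue]) (use e(3) in blast)
    also have "nS g * \<eta> < \<epsilon> / 2" using nS_nonneg[OF g] \<open>0 < \<epsilon>\<close> by (simp add: \<eta>_def field_simps)
    finally show ?thesis using e by auto
  qed
  then show ?thesis by blast
qed

text \<open>Iterating bounded approximate units writes \<open>\<psi>\<close> as an absolutely convergent series
  \<open>\<Sum>n. e n * \<psi>s n\<close> in \<open>S\<close>, each term of which stays in \<open>S\<close> after multiplication by \<open>\<phi>\<close>.\<close>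

lemma C_BSE_mult_S:
  assumes \<phi>: "\<phi> \<in> C_BSE pair (closure V)" and \<psi>: "\<psi> \<in> S"
  shows "(\<lambda>t. \<phi> t * \<psi> t) \<in> S"
proof -
  obtain B where B: "\<And>\<gamma>. bse_bound pair (T \<gamma>) \<phi> B" using \<phi> C_BSE_iff by blast
  have "0 \<le> B" using bse_bound_nonneg[OF B] .
  obtain C where "\<forall>g\<in>S. \<forall>\<epsilon>>0. \<exists>e\<in>A_alg pair (closure V).
     (\<forall>\<gamma>. bse_bound pair (T \<gamma>) e C) \<and> nS (\<lambda>t. g t - e t * g t) < \<epsilon>"
    using S_bounded_approximate_unit by blast
  then have "\<exists>e. g \<in> S \<longrightarrow> e \<in> A_alg pair (closure V) \<and> (\<forall>\<gamma>. bse_bound pair (T \<gamma>) e C) \<and>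
      nS (\<lambda>t. g t - e t * g t) < (1/2) ^ n" for g n
    by (cases "g \<in> S") (auto dest!: bspec[of _ _ g] spec[of _ "(1/2) ^ n"])
  then obtain E where E: "\<And>g n. g \<in> S \<Longrightarrow> E g n \<in> A_alg pair (closure V) \<and>
      (\<forall>\<gamma>. bse_bound pair (T \<gamma>) (E g n) C) \<and> nS (\<lambda>t. g t - E g n t * g t) < (1/2) ^ n"
    by metis
  \<comment> \<open>The successive remainders; the index \<open>Suc n\<close> gives
    \<open>nS (\<psi>s (Suc n)) < (1/2) ^ Suc n\<close>.\<close>
  define \<psi>s where "\<psi>s = rec_nat \<psi> (\<lambda>n g t. g t - E g (Suc n) t * g t)"
  define e where "e n = E (\<psi>s n) (Suc n)" for n
  have \<psi>s0: "\<psi>s 0 = \<psi>" and \<psi>sSuc: "\<psi>s (Suc n) = (\<lambda>t. \<psi>s n t - e n t * \<psi>s n t)" for n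
    by (auto simp: \<psi>s_def e_def)
  have \<psi>sS: "\<psi>s n \<in> S" for n
  proof (induction n)
    case 0
    then show ?case using \<psi> by (simp add: \<psi>s0)
  next
    case (Suc n)
    then have "(\<lambda>t. \<psi>s n t * e n t) \<in> S" using S_ideal E by (simp add: e_def)
    then show ?case using S_diff[OF Suc] by (simp add: \<psi>sSuc mult.commute)
  qed
  have e: "e n \<in> A_alg pair (closure V)" "\<And>\<gamma>. bse_bound pair (T \<gamma>) (e n) C" for n
    using E[OF \<psi>sS] by (auto simp: e_def)
  have "0 \<le> C" using bse_bound_nonneg[OF e(2)] .
  \<comment> \<open>Covers both the start, of norm \<open>nS \<psi>\<close>, and the later
    remainders, for which 1 would do.\<close>
  define D where "D = nS \<psi> + 1"
  have \<psi>sD: "nS (\<psi>s n) \<le> D * (1/2) ^ n" for n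
  proof (cases n)
    case (Suc m)
    have "nS (\<psi>s n) < (1/2) ^ n" using E[OF \<psi>sS, of m "Suc m"] by (simp add: Suc \<psi>sSuc e_def)
    also have "\<dots> \<le> D * (1/2) ^ n" using nS_nonneg[OF \<psi>] by (simp add: D_def)
    finally show ?thesis by simp
  qed (simp add: \<psi>s0 D_def)
  have e\<phi>: "(\<lambda>t. \<phi> t * e n t) \<in> A_alg pair (closure V)" for n by (rule A_alg_mult[OF \<phi> e(1)])
  define s where "s n t = \<phi> t * (\<psi> t - \<psi>s n t)" for n t
  \<comment> \<open>\<open>\<phi>\<close> is attached to \<open>e n\<close> because
    \<open>\<phi> * \<psi>s n\<close> is not yet known to lie in \<open>S\<close>, whereas
    \<open>\<phi> * e n\<close> lies in the algebra.\<close>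
  have step: "(\<lambda>t. s (Suc n) t - s n t) = (\<lambda>t. \<psi>s n t * (\<phi> t * e n t))" for n
    by (simp add: s_def \<psi>sSuc algebra_simps)
  have stepS: "(\<lambda>t. s (Suc n) t - s n t) \<in> S" for n
    unfolding step by (rule S_ideal[OF \<psi>sS e\<phi>])
  show ?thesis
  proof (rule S_limit_mem)
    show "s n \<in> S" for n
    proof (induction n)
      case 0
      then show ?case using S_zero by (simp add: s_def[abs_def] \<psi>s0)
    next
      case (Suc n)
      show ?case using S_add[OF Suc stepS[of n]] by simp
    qed
    show "nS (\<lambda>t. s (Suc n) t - s n t) \<le> (D * (B * C)) * (1/2) ^ n" for n
    proof -
      have "nS (\<lambda>t. s (Suc n) t - s n t) \<le> nS (\<psi>s n) * (B * C)"
        unfolding step by (rule nS_mult[OF \<psi>sS e\<phi> bse_bound_mult[OF B e(2)]])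
      also have "\<dots> \<le> (D * (1/2) ^ n) * (B * C)"
        using \<psi>sD \<open>0 \<le> B\<close> \<open>0 \<le> C\<close> by (intro mult_right_mono) auto
      finally show ?thesis by (simp add: mult_ac)
    qed
    show "(\<lambda>n. s n t) \<longlonglongrightarrow> \<phi> t * \<psi> t" for t
    proof -
      have bd: "\<forall>n. norm (\<psi>s n t) \<le> D * (1/2) ^ n"
        using order_trans[OF norm_le_nS[OF \<psi>sS] \<psi>sD] by blast
      have "(\<lambda>n. D * (1/2) ^ n) \<longlonglongrightarrow> D * 0" by (intro tendsto_mult_left LIMSEQ_power_zero) simp
      then have "(\<lambda>n. D * (1/2) ^ n) \<longlonglongrightarrow> 0" by simp
      then have "(\<lambda>n. \<psi>s n t) \<longlonglongrightarrow> 0" by (rule Lim_null_comparison[OF always_eventually[OF bd]])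
      then have "(\<lambda>n. \<phi> t * (\<psi> t - \<psi>s n t)) \<longlonglongrightarrow> \<phi> t * (\<psi> t - 0)" by (intro tendsto_intros)
      then show ?thesis by (simp add: s_def)
    qed
  qed
qed

text \<open>If \<open>g \<in> S\<close> is close to a plateau function \<open>u\<close> on the support of \<open>w\<close> and \<open>r = u - g\<close>, then
  \<open>w = w * g * (\<Sum>n. r ^ n)\<close>.\<close>

lemma compact_support_S:
  assumes w: "w \<in> A_alg pair (closure V)" and Q: "compact Q" "\<And>t. t \<notin> Q \<Longrightarrow> w t = 0"
  shows "w \<in> S"
proof -
  obtain u where u: "u \<in> A_alg pair (closure V)" "\<forall>t\<in>Q. u t = 1"
    using plateau_A_alg Q(1) by blast
  obtain g where g: "g \<in> S" "\<forall>\<gamma>. bse_bound pair (T \<gamma>) (\<lambda>t. u t - g t) (1/2)"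
    using S_dense[OF u(1), of "1/2"] by auto
  define r where "r t = u t - g t" for t
  have r: "r \<in> A_alg pair (closure V)" unfolding r_def by (rule A_alg_diff[OF u(1) S_A_alg[OF g(1)]])
  have rb: "bse_bound pair (T \<gamma>) r (1/2)" for \<gamma> using g(2) unfolding r_def[abs_def] by blast
  have a: "(\<lambda>t. g t * w t * r t ^ n) \<in> S \<and> nS (\<lambda>t. g t * w t * r t ^ n) \<le> nS (\<lambda>t. g t * w t) * (1/2) ^ n" for n
  proof (induction n)
    case 0
    then show ?case using S_ideal[OF g(1) w] by simp
  next
    case (Suc n)
    have eq: "(\<lambda>t. g t * w t * r t ^ Suc n) = (\<lambda>t. g t * w t * r t ^ n * r t)" by (simp add: mult_ac)
    have "nS (\<lambda>t. g t * w t * r t ^ n * r t) \<le> nS (\<lambda>t. g t * w t * r t ^ n) * (1/2)"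
      using nS_mult[OF _ r rb] Suc by blast
    also have "\<dots> \<le> nS (\<lambda>t. g t * w t) * (1/2) ^ n * (1/2)" using Suc by simp
    finally show ?case using S_ideal[OF _ r] Suc unfolding eq by simp
  qed
  \<comment> \<open>The closed form of \<open>w * g * (\<Sum>k<n. r ^ k)\<close>: on
    \<open>Q\<close> one has \<open>g = 1 - r\<close>, and off \<open>Q\<close> both vanish with
    \<open>w\<close>.\<close>
  define s where "s n t = w t * (1 - r t ^ n)" for n t
  have step: "(\<lambda>t. s (Suc n) t - s n t) = (\<lambda>t. g t * w t * r t ^ n)" for n
  proof
    fix t
    show "s (Suc n) t - s n t = g t * w t * r t ^ n"
    proof (cases "t \<in> Q")
      case True
      then have gt: "g t = 1 - r t" using u(2) by (simp add: r_def)
      show ?thesis unfolding s_def gt by (simp add: algebra_simps)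
    qed (simp add: s_def Q(2))
  qed
  show ?thesis
  proof (rule S_limit_mem)
    show "s n \<in> S" for n
    proof (induction n)
      case 0
      then show ?case using S_zero by (simp add: s_def[abs_def])
    next
      case (Suc n)
      have "(\<lambda>t. s (Suc n) t - s n t) \<in> S" using a step by simp
      from S_add[OF Suc this] show ?case by simp
    qed
    show "nS (\<lambda>t. s (Suc n) t - s n t) \<le> nS (\<lambda>t. g t * w t) * (1/2) ^ n" for n
      using a step by simp
    show "(\<lambda>n. s n t) \<longlonglongrightarrow> w t" for t
    proof -
      have "norm (r t) \<le> 1/2" by (rule norm_le_bse_bound[OF rb mem_T_self])
      then have "norm (r t) < 1" by linarith
      then have "(\<lambda>n. r t ^ n) \<longlonglongrightarrow> 0" by (rule LIMSEQ_power_zero)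
      then have "(\<lambda>n. w t * (1 - r t ^ n)) \<longlonglongrightarrow> w t * (1 - 0)"
        by (rule tendsto_mult_left[OF tendsto_diff[OF tendsto_const]])
      then show ?thesis by (simp add: s_def)
    qed
  qed
qed

section \<open>Local bounds for multipliers\<close>

lemma plateau_S:
  assumes "compact K"
  shows "\<exists>w Q. w \<in> S \<and> compact Q \<and> (\<forall>t\<in>K. w t = 1) \<and> (\<forall>t. t \<notin> Q \<longrightarrow> w t = 0)"
proof -
  obtain w Q where "w \<in> A_alg pair (closure V)" "compact Q" "\<forall>t\<in>K. w t = 1" "\<forall>t. t \<notin> Q \<longrightarrow> w t = 0"
    using plateau_A_alg assms by blast
  moreover from this have "w \<in> S" by (intro compact_support_S) auto
  ultimately show ?thesis by blast
qed

text \<open>For \<open>w\<close> in \<open>S\<close> equal to 1 on \<open>closure V + K\<close>, the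
  product \<open>\<phi> * w\<close> lies in \<open>S\<close> and agrees with \<open>\<phi>\<close>
  on each \<open>T \<gamma>\<close> with \<open>\<gamma>\<close> in \<open>K\<close>.\<close>

lemma multiplier_locally_bounded:
  assumes \<phi>: "\<phi> \<in> multipliers S" and K: "compact K"
  shows "\<exists>B. \<forall>\<gamma>\<in>K. bse_bound pair (T \<gamma>) \<phi> B"
proof -
  obtain w where w: "w \<in> S" "\<forall>t\<in>{v + k |v k. v \<in> closure V \<and> k \<in> K}. w t = 1"
    using plateau_S[OF compact_plus[OF V_cpt K]] by blast
  have \<phi>w: "(\<lambda>t. \<phi> t * w t) \<in> S" using \<phi> w(1) by (simp add: multipliers_def)
  have "bse_bound pair (T \<gamma>) \<phi> (nS (\<lambda>t. \<phi> t * w t))" if "\<gamma> \<in> K" for \<gamma>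
  proof (rule bse_bound_cong[THEN iffD1, OF _ bse_bound_nS[OF \<phi>w]])
    fix t assume "t \<in> T \<gamma>"
    then have "t \<in> {v + k |v k. v \<in> closure V \<and> k \<in> K}" using that by blast
    then show "\<phi> t * w t = \<phi> t" using w(2) by simp
  qed
  then show ?thesis by blast
qed

text \<open>Gliding hump: if the local norms of \<open>\<phi>\<close> were unbounded, they would exceed \<open>4 ^ k\<close> at points
  \<open>\<gamma> k\<close> so far apart that \<open>\<Sum>k. (1/2) ^ k * w (t - \<gamma> k)\<close>, with \<open>w \<in> S\<close> a plateau function, equals
  \<open>(1/2) ^ k\<close> on \<open>T (\<gamma> k)\<close>.\<close>

lemma multiplier_in_C_BSE:
  assumes inv: "isometrically_translation_invariant S nS" and \<phi>: "\<phi> \<in> multipliers S"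
  shows "\<phi> \<in> C_BSE pair (closure V)"
proof (rule ccontr)
  assume notin: "\<phi> \<notin> C_BSE pair (closure V)"
  have "continuous_on UNIV \<phi>" using \<phi> by (simp add: multipliers_def Cb_def)
  then have unb: "\<not> (\<forall>\<gamma>. bse_bound pair (T \<gamma>) \<phi> B)" for B using notin C_BSE_iff by blast
  have far: "\<exists>\<gamma>. \<gamma> \<notin> K \<and> \<not> bse_bound pair (T \<gamma>) \<phi> B" if K: "compact K" for K B
  proof (rule ccontr)
    assume *: "\<not> ?thesis"
    obtain B' where B': "\<forall>\<gamma>\<in>K. bse_bound pair (T \<gamma>) \<phi> B'"
      using multiplier_locally_bounded[OF \<phi> K] by blast
    have "bse_bound pair (T \<gamma>) \<phi> (max B B')" for \<gamma>
    proof (cases "\<gamma> \<in> K")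
      case True
      then show ?thesis using bse_bound_mono[OF B'[rule_format] order_refl] by simp
    next
      case False
      then have "bse_bound pair (T \<gamma>) \<phi> B" using * by blast
      then show ?thesis by (rule bse_bound_mono) auto
    qed
    then show False using unb by blast
  qed
  obtain w Q where w: "w \<in> S" "compact Q" "\<forall>t\<in>closure V. w t = 1" "\<forall>t. t \<notin> Q \<longrightarrow> w t = 0"
    using plateau_S[OF V_cpt] by blast
  \<comment> \<open>\<open>D\<close> is symmetric, so avoiding it for \<open>j < k\<close> also
    keeps \<open>T (\<gamma> j)\<close> away from the support of the later hump at
    \<open>\<gamma> k\<close>.\<close>
  define D where "D = {q - v |q v. q \<in> Q \<and> v \<in> closure V} \<union> {v - q |v q. v \<in> closure V \<and> q \<in> Q}"
  have "compact D" unfolding D_def using compact_Un compact_minus[OF w(2) V_cpt] compact_minus[OF V_cpt w(2)] .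
  have "\<exists>\<gamma>::nat \<Rightarrow> 'a. \<forall>k. (\<forall>j<k. \<gamma> k - \<gamma> j \<notin> D) \<and> \<not> bse_bound pair (T (\<gamma> k)) \<phi> (4 ^ k)"
  proof (rule dependent_wellorder_choice)
    fix f :: "nat \<Rightarrow> 'a" and k
    have "compact (\<Union>j<k. (\<lambda>d. d + f j) ` D)"
      by (intro compact_UN compact_translation_group \<open>compact D\<close>) simp
    from far[OF this, of "4 ^ k"] obtain \<gamma>
      where \<gamma>: "\<gamma> \<notin> (\<Union>j<k. (\<lambda>d. d + f j) ` D)" "\<not> bse_bound pair (T \<gamma>) \<phi> (4 ^ k)" by blast
    have "\<gamma> - f j \<notin> D" if "j < k" for j
    proof
      assume "\<gamma> - f j \<in> D"
      then have "\<gamma> \<in> (\<lambda>d. d + f j) ` D" by (rule rev_image_eqI) simp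
      then show False using \<gamma>(1) that by blast
    qed
    then show "\<exists>\<gamma>. (\<forall>j<k. \<gamma> - f j \<notin> D) \<and> \<not> bse_bound pair (T \<gamma>) \<phi> (4 ^ k)" using \<gamma>(2) by blast
  qed simp
  then obtain \<gamma> :: "nat \<Rightarrow> 'a" where sep: "\<And>j k. j < k \<Longrightarrow> \<gamma> k - \<gamma> j \<notin> D"
    and big: "\<And>k. \<not> bse_bound pair (T (\<gamma> k)) \<phi> (4 ^ k)" by blast
  have disj: "w (t - \<gamma> j) = 0" if t: "t \<in> T (\<gamma> k)" and "j \<noteq> k" for t j k
  proof -
    obtain v where v: "v \<in> closure V" "t = v + \<gamma> k" using t by blast
    have "t - \<gamma> j \<notin> Q"
    proof
      assume q: "t - \<gamma> j \<in> Q"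
      have "(t - \<gamma> j) - v \<in> D" "v - (t - \<gamma> j) \<in> D" using q v(1) unfolding D_def by blast+
      then have "\<gamma> k - \<gamma> j \<in> D" "\<gamma> j - \<gamma> k \<in> D" using v(2) by (simp_all add: algebra_simps)
      then show False using sep \<open>j \<noteq> k\<close> by (meson linorder_neqE_nat)
    qed
    then show ?thesis using w(4) by blast
  qed
  have wS: "(\<lambda>t. w (t - \<gamma>)) \<in> S" "nS (\<lambda>t. w (t - \<gamma>)) = nS w" for \<gamma>
    using inv w(1) unfolding isometrically_translation_invariant_def by blast+
  define s where "s n t = (\<Sum>k<n. (1/2) ^ k * w (t - \<gamma> k))" for n t
  have "\<exists>f\<in>S. \<forall>t. (\<lambda>n. s n t) \<longlonglongrightarrow> f t"
  proof (rule S_geometric_limit)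
    show "s n \<in> S" for n
    proof (induction n)
      case 0
      then show ?case using S_zero by (simp add: s_def[abs_def])
    next
      case (Suc n)
      from S_add[OF Suc S_scale[OF wS(1), of "(1/2) ^ n" "\<gamma> n"]] show ?case by (simp add: s_def[abs_def])
    qed
    \<comment> \<open>Isometric invariance enters here: each hump costs \<open>nS w\<close> times
      its weight, wherever it sits.\<close>
    show "nS (\<lambda>t. s (Suc n) t - s n t) \<le> nS w * (1/2) ^ n" for n
      using nS_scale[OF wS(1), of "(1/2) ^ n" "\<gamma> n"] wS(2) by (simp add: s_def norm_power norm_divide)
  qed
  then obtain f where f: "f \<in> S" "\<forall>t. (\<lambda>n. s n t) \<longlonglongrightarrow> f t" by blast
  have fk: "f t = (1/2) ^ k" if t: "t \<in> T (\<gamma> k)" for t k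
  proof -
    have "s n t = (1/2) ^ k" if n: "n \<ge> Suc k" for n
    proof -
      have "s n t = (\<Sum>j\<in>{k}. (1/2) ^ j * w (t - \<gamma> j))"
        unfolding s_def using n disj[OF t] by (intro sum.mono_neutral_right) auto
      moreover have "w (t - \<gamma> k) = 1" using w(3) t by auto
      ultimately show ?thesis by simp
    qed
    then have "(\<lambda>n. s n t) \<longlonglongrightarrow> (1/2) ^ k"
      by (intro tendsto_eventually) (auto simp: eventually_sequentially)
    then show ?thesis using f(2) LIMSEQ_unique by blast
  qed
  have \<phi>f: "(\<lambda>t. \<phi> t * f t) \<in> S" using \<phi> f(1) by (simp add: multipliers_def)
  define R where "R = nS (\<lambda>t. \<phi> t * f t)"
  \<comment> \<open>Undoing the weight costs \<open>2 ^ k\<close>, and a further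
    \<open>2 ^ k\<close> outgrows the fixed \<open>R\<close>; hence the threshold
    \<open>4 ^ k\<close>.\<close>
  obtain k where k: "R < 2 ^ k" using real_arch_pow[of 2 R] by auto
  have "bse_bound pair (T (\<gamma> k)) (\<lambda>t. 2 ^ k * (\<phi> t * f t)) (norm (2 ^ k :: complex) * R)"
    unfolding R_def by (rule bse_bound_cmult[OF bse_bound_nS[OF \<phi>f]])
  then have "bse_bound pair (T (\<gamma> k)) \<phi> (norm (2 ^ k :: complex) * R)"
    by (rule bse_bound_cong[THEN iffD1, rotated]) (simp add: fk power_divide)
  moreover have "norm (2 ^ k :: complex) * R \<le> 4 ^ k"
  proof -
    have "2 ^ k * R \<le> 2 ^ k * 2 ^ k" using k by (intro mult_left_mono) auto
    then show ?thesis by (simp add: norm_power power_mult_distrib[symmetric])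
  qed
  ultimately have "bse_bound pair (T (\<gamma> k)) \<phi> (4 ^ k)" by (rule bse_bound_mono[OF _ order_refl])
  then show False using big by blast
qed

end

section \<open>From the dual group to the abstract pairing, and the conclusion\<close>

lemma pairing_of_dual_pairing:
  assumes "is_dual_pairing pair"
  shows "pairing pair"
proof
  note dual = assms[unfolded is_dual_pairing_def]
  have char: "is_character (\<lambda>x. pair x \<gamma>)" for \<gamma>
    by (rule dual[THEN conjunct2, THEN conjunct1, rule_format])
  show "norm (pair x \<gamma>) = 1" "pair (x + y) \<gamma> = pair x \<gamma> * pair y \<gamma>" for x y \<gamma>
    using char[of \<gamma>] by (simp_all add: is_character_def)
  show right: "pair x (\<gamma> + \<delta>) = pair x \<gamma> * pair x \<delta>" for x \<gamma> \<delta>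
    by (rule dual[THEN conjunct2, THEN conjunct2, THEN conjunct2, THEN conjunct2, THEN conjunct1, rule_format])
  show "continuous_on UNIV (pair x)" for x
    unfolding continuous_on_open_vimage[OF open_UNIV]
  proof (intro allI impI)
    fix W :: "complex set" assume "open W"
    \<comment> \<open>With the singleton \<open>{x}\<close> as compact set, the preimage is a
      subbasic set of the compact-open topology.\<close>
    then have "pair x -` W \<in> {{\<gamma>. \<forall>x\<in>K. pair x \<gamma> \<in> W} | K W. compact K \<and> open W}"
      by (intro CollectI exI[of _ "{x}"] exI[of _ W]) auto
    then show "open (pair x -` W \<inter> UNIV)"
      unfolding Int_UNIV_right
        dual[THEN conjunct2, THEN conjunct2, THEN conjunct2, THEN conjunct2, THEN conjunct2, rule_format]
      by (rule generate_topology_on.Basis)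
  qed
  show "\<exists>x. pair x \<gamma> \<noteq> 1" if "\<gamma> \<noteq> 0" for \<gamma>
  proof (rule ccontr)
    assume "\<not> ?thesis"
    moreover have "pair x 0 = 1" for x
    proof -
      have "norm (pair x 0) = 1" using char[of 0] unfolding is_character_def by blast
      then have "pair x 0 \<noteq> 0" by auto
      then show ?thesis using right[of x 0 0] by simp
    qed
    ultimately have "(\<lambda>x. pair x \<gamma>) = (\<lambda>x. pair x 0)" by auto
    then have "\<gamma> = 0" by (rule injD[OF dual[THEN conjunct2, THEN conjunct2, THEN conjunct1]])
    then show False using that by simp
  qed
qed

theorem theorem6p1:
  fixes pair :: "'g::{topological_ab_group_add,t2_space} \<Rightarrow> 'a::topological_ab_group_add \<Rightarrow> complex"
    and V :: "'a set"
    and S :: "('a \<Rightarrow> complex) set"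
    and nS :: "('a \<Rightarrow> complex) \<Rightarrow> real"
  assumes dual: "is_dual_pairing pair"
    and nondiscrete: "\<not> open {0::'g}"
    and V_open: "open V" and V_zero: "0 \<in> V" and V_cpt: "compact (closure V)"
    and segal: "segal_algebra pair (closure V) S nS"
  shows "C_BSE pair (closure V) \<subseteq> multipliers S
         \<and> (isometrically_translation_invariant S nS \<longrightarrow> multipliers S = C_BSE pair (closure V))"
proof -
  interpret pairing pair by (rule pairing_of_dual_pairing[OF dual])
  interpret segal_alg pair V S nS by unfold_locales (fact V_open V_zero V_cpt segal)+
  have "C_BSE pair (closure V) \<subseteq> multipliers S"
  proof
    fix \<phi> assume \<phi>: "\<phi> \<in> C_BSE pair (closure V)"
    then have "\<phi> \<in> Cb" by (simp add: C_BSE_def)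
    then show "\<phi> \<in> multipliers S" using C_BSE_mult_S[OF \<phi>] by (simp add: multipliers_def)
  qed
  then show ?thesis using multiplier_in_C_BSE by blast
qed

end
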